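(* Let $\mathcal{A}$ be a bialgebra and let $\mathcal{R}$ be a family of right $\mathcal{A}$-comodules such that the linear span of the coefficient coalgebras $\mathcal{C}(M)$, $M\in\mathcal{R}$, coincides with $\mathcal{A}$. Let $\mathbf{r}$ be a convolution invertible linear functional on $\mathcal{A}\otimes\mathcal{A}$. Then $\mathbf{r}$ is a universal $r$-form of $\mathcal{A}$ if and only if, for every comodule $M\in\mathcal{R}$, both $M_1$ and $M_2$ are (right) Yetter-Drinfeld modules of $\mathcal{A}$.
   Context: All algebras and coalgebras are over a fixed ground field; algebras are unital and modules are unital. Sweedler notation: $\Delta(a)=a_{(1)}\otimes a_{(2)}$ for the comultiplication, $\delta(m)=m_{(0)}\otimes m_{(1)}\in M\otimes\mathcal{A}$ for a right coaction. The convolution inverse of a linear functional $\mathbf{r}$ on $\mathcal{A}\otimes\mathcal{A}$ is denoted $\bar{\mathbf{r}}$. A universal $r$-form on a bialgebra $\mathcal{A}$ is a convolution invertible linear functional $\mathbf{r}$ on $\mathcal{A}\otimes\mathcal{A}$ such that for all $a,b,c\in\mathcal{A}$: (CQT.1) $\mathbf{r}(c\otimes ab)=\mathbf{r}(c_{(1)}\otimes b)\,\mathbf{r}(c_{(2)}\otimes a)$; (CQT.2) $\mathbf{r}(ab\otimes c)=\mathbf{r}(a\otimes c_{(1)})\,\mathbf{r}(b\otimes c_{(2)})$; (CQT.3) $\mathbf{r}(a_{(1)}\otimes b_{(1)})\,a_{(2)}b_{(2)}=\mathbf{r}(a_{(2)}\otimes b_{(2)})\,b_{(1)}a_{(1)}$.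 A (right) Yetter-Drinfeld module of $\mathcal{A}$ is a right $\mathcal{A}$-module (action $m\triangleleft a$) and right $\mathcal{A}$-comodule $M$ such that for all $m\in M$, $a\in\mathcal{A}$: $$m_{(0)}\triangleleft a_{(1)}\otimes m_{(1)}a_{(2)}=(m\triangleleft a_{(2)})_{(0)}\otimes a_{(1)}(m\triangleleft a_{(2)})_{(1)}.$$ For a right $\mathcal{A}$-comodule $M$ with (algebraic) dual space $M'$, the coefficient coalgebra is $\mathcal{C}(M)=\mathrm{Lin}\{m'(m_{(0)})\,m_{(1)} : m\in M,\ m'\in M'\}\subseteq\mathcal{A}$. For a right $\mathcal{A}$-comodule $M$, $m\in M$, $a\in\mathcal{A}$, set $$m\triangleleft_1 a=\mathbf{r}(m_{(1)}\otimes a)\,m_{(0)},\qquad m\triangleleft_2 a=\bar{\mathbf{r}}(a\otimes m_{(1)})\,m_{(0)}.$$ For $i=1,2$, $M_i$ denotes the right $\mathcal{A}$-comodule $M$ equipped with the mapping $M\times\mathcal{A}\to M$, $(m,a)\mapsto m\triangleleft_i a$; saying that $M_i$ is a Yetter-Drinfeld module means that $\triangleleft_i$ is a right action of $\mathcal{A}$ on $M$ and that, together with the given coaction, it satisfies the Yetter-Drinfeld condition. *)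

theory Defs
  imports Complex_Main "HOL-Library.Function_Algebras"
begin

section \<open>Vector spaces and tensor products\<close>

text \<open>
  A vector space over the field 'k is a linear subspace (\<open>vcarrier\<close>) of an ambient additive group
  made into a 'k-vector space by \<open>vscale\<close>. Carriers are needed because the members of a family
  of comodules live on different vector spaces; every set of vector spaces can be realised in one
  ambient space, for instance in its direct sum. Values of maps outside the carriers are irrelevant.
\<close>

record ('k, 'v) vspace =
  vcarrier :: "'v set"
  vscale :: "'k \<Rightarrow> 'v \<Rightarrow> 'v"

definition is_vspace :: "('k::field, 'v::ab_group_add, 'z) vspace_scheme \<Rightarrow> bool" where
  "is_vspace V \<longleftrightarrow> vector_space (vscale V) \<and> module.subspace (vscale V) (vcarrier V)"

definition ground :: "('k::field, 'k) vspace" where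
  "ground = \<lparr>vcarrier = UNIV, vscale = (*)\<rparr>"

definition linear_map ::
  "('k::field, 'v::ab_group_add, 'y) vspace_scheme \<Rightarrow> ('k, 'w::ab_group_add, 'z) vspace_scheme
    \<Rightarrow> ('v \<Rightarrow> 'w) \<Rightarrow> bool" where
  "linear_map V W f \<longleftrightarrow>
     (\<forall>x\<in>vcarrier V. f x \<in> vcarrier W) \<and>
     (\<forall>x\<in>vcarrier V. \<forall>y\<in>vcarrier V. f (x + y) = f x + f y) \<and>
     (\<forall>c. \<forall>x\<in>vcarrier V. f (vscale V c x) = vscale W c (f x))"

definition bilinear_map ::
  "('k::field, 'u::ab_group_add, 'x) vspace_scheme \<Rightarrow> ('k, 'v::ab_group_add, 'y) vspace_scheme
    \<Rightarrow> ('k, 'w::ab_group_add, 'z) vspace_scheme \<Rightarrow> ('u \<Rightarrow> 'v \<Rightarrow> 'w) \<Rightarrow> bool" where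
  "bilinear_map U V W f \<longleftrightarrow>
     (\<forall>x\<in>vcarrier U. linear_map V W (f x)) \<and>
     (\<forall>y\<in>vcarrier V. linear_map U W (\<lambda>x. f x y))"

text \<open>
  Concrete model of the algebraic tensor product over a field: \<open>x \<otimes> y\<close> is evaluation at \<open>(x, y)\<close>,
  as a functional on the bilinear forms on \<open>U \<times> V\<close>, and \<open>U \<otimes> V\<close> is the span of these functionals.
  The universal property is \<open>tensor_universal\<close> below.
\<close>

type_synonym ('k, 'u, 'v) tensor = "('u \<Rightarrow> 'v \<Rightarrow> 'k) \<Rightarrow> 'k"

definition tens ::
  "('k::field, 'u::ab_group_add, 'y) vspace_scheme \<Rightarrow> ('k, 'v::ab_group_add, 'z) vspace_scheme
    \<Rightarrow> 'u \<Rightarrow> 'v \<Rightarrow> ('k, 'u, 'v) tensor" where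
  "tens U V x y = (\<lambda>\<beta>. if bilinear_map U V ground \<beta> then \<beta> x y else 0)"

definition tensor_scale :: "'k::field \<Rightarrow> ('k, 'u, 'v) tensor \<Rightarrow> ('k, 'u, 'v) tensor" where
  "tensor_scale c t = (\<lambda>\<beta>. c * t \<beta>)"

definition tensor_prod ::
  "('k::field, 'u::ab_group_add, 'y) vspace_scheme \<Rightarrow> ('k, 'v::ab_group_add, 'z) vspace_scheme
    \<Rightarrow> ('k, ('k, 'u, 'v) tensor) vspace" where
  "tensor_prod U V =
     \<lparr>vcarrier = module.span tensor_scale {tens U V x y |x y. x \<in> vcarrier U \<and> y \<in> vcarrier V},
      vscale = tensor_scale\<rparr>"

text \<open>
  \<open>tlift U V f\<close> is the linear map on \<open>U \<otimes> V\<close> induced by a bilinear map \<open>f\<close>. It is how Sweedler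
  notation is rendered: \<open>f(a\<^sub>1, a\<^sub>2)\<close> is \<open>tlift A A f (\<Delta> a)\<close>, and \<open>f(m\<^sub>0, m\<^sub>1)\<close> is
  \<open>tlift M A f (\<delta> m)\<close>. For bilinear \<open>f\<close> the value does not depend on the chosen representation
  (\<open>tlift_sum\<close>).
\<close>

definition tlift ::
  "('k::field, 'u::ab_group_add, 'y) vspace_scheme \<Rightarrow> ('k, 'v::ab_group_add, 'z) vspace_scheme
    \<Rightarrow> ('u \<Rightarrow> 'v \<Rightarrow> 'w::ab_group_add) \<Rightarrow> ('k, 'u, 'v) tensor \<Rightarrow> 'w" where
  "tlift U V f t =
     (let ps = (SOME ps. set ps \<subseteq> vcarrier U \<times> vcarrier V \<and>
                         t = sum_list (map (\<lambda>(x, y). tens U V x y) ps))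
      in sum_list (map (\<lambda>(x, y). f x y) ps))"


lemma vector_space_tensor_scale: "vector_space tensor_scale"
  by unfold_locales (auto simp: tensor_scale_def fun_eq_iff algebra_simps)

lemma vector_space_ground: "vector_space ((*) :: 'k::field \<Rightarrow> 'k \<Rightarrow> 'k)"
  by unfold_locales (auto simp: algebra_simps)

lemma is_vspace_ground: "is_vspace (ground :: ('k::field, 'k) vspace)"
proof -
  interpret vector_space "(*) :: 'k \<Rightarrow> 'k \<Rightarrow> 'k" by (rule vector_space_ground)
  show ?thesis by (simp add: is_vspace_def ground_def vector_space_axioms)
qed

lemma is_vspace_tensor_prod: "is_vspace (tensor_prod U V)"
proof -
  interpret vector_space tensor_scale by (rule vector_space_tensor_scale)
  show ?thesis
    by (simp add: is_vspace_def tensor_prod_def vector_space_axioms)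
qed

lemma tens_in_tensor_prod:
  assumes "x \<in> vcarrier U" "y \<in> vcarrier V"
  shows "tens U V x y \<in> vcarrier (tensor_prod U V)"
proof -
  interpret vector_space tensor_scale by (rule vector_space_tensor_scale)
  show ?thesis using assms by (auto simp: tensor_prod_def intro!: span_base)
qed

lemma bilinear_tens: "bilinear_map U V (tensor_prod U V) (tens U V)"
proof -
  have "vscale (tensor_prod U V) = tensor_scale" by (simp add: tensor_prod_def)
  then show ?thesis
    by (auto simp: bilinear_map_def linear_map_def tens_in_tensor_prod)
       (auto simp: tens_def tensor_scale_def fun_eq_iff bilinear_map_def linear_map_def ground_def)
qed

lemma tensor_prod_carrier_iff:
  assumes "is_vspace U"
  shows "t \<in> vcarrier (tensor_prod U V) \<longleftrightarrow>
    (\<exists>ps. set ps \<subseteq> vcarrier U \<times> vcarrier V \<and> t = sum_list (map (\<lambda>(x, y). tens U V x y) ps))"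
    (is "_ \<longleftrightarrow> ?rep t")
proof
  interpret T: vector_space tensor_scale by (rule vector_space_tensor_scale)
  interpret U: vector_space "vscale U" using assms by (simp add: is_vspace_def)
  have sub: "U.subspace (vcarrier U)" using assms by (simp add: is_vspace_def)
  let ?B = "{tens U V x y |x y. x \<in> vcarrier U \<and> y \<in> vcarrier V}"
  assume "t \<in> vcarrier (tensor_prod U V)"
  then have "t \<in> T.span ?B" by (simp add: tensor_prod_def)
  then show "?rep t"
  proof (induction rule: T.span_induct_alt)
    case base
    show ?case by (rule exI[of _ "[]"]) simp
  next
    case (step c b t)
    then obtain x y ps where *: "x \<in> vcarrier U" "y \<in> vcarrier V" "b = tens U V x y"
      "set ps \<subseteq> vcarrier U \<times> vcarrier V" "t = sum_list (map (\<lambda>(x, y). tens U V x y) ps)"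
      by blast
    have "tensor_scale c b = tens U V (vscale U c x) y"
      using bilinear_tens[of U V] *(1-3)
      by (simp add: bilinear_map_def linear_map_def tensor_prod_def)
    then show ?case
      using * U.subspace_scale[OF sub *(1), of c]
      by (intro exI[of _ "(vscale U c x, y) # ps"]) auto
  qed
next
  interpret T: vector_space tensor_scale by (rule vector_space_tensor_scale)
  assume "?rep t"
  then obtain ps where ps: "set ps \<subseteq> vcarrier U \<times> vcarrier V"
    "t = sum_list (map (\<lambda>(x, y). tens U V x y) ps)" by blast
  have sub: "T.subspace (vcarrier (tensor_prod U V))"
    by (simp add: tensor_prod_def)
  have "set ps \<subseteq> vcarrier U \<times> vcarrier V \<Longrightarrow>
    sum_list (map (\<lambda>(x, y). tens U V x y) ps) \<in> vcarrier (tensor_prod U V)"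
    by (induction ps) (auto intro!: T.subspace_add[OF sub] T.subspace_0[OF sub] tens_in_tensor_prod)
  then show "t \<in> vcarrier (tensor_prod U V)" using ps by simp
qed

lemma separating_functional:
  assumes "vector_space (s :: 'k::field \<Rightarrow> 'v::ab_group_add \<Rightarrow> 'v)" "d \<noteq> 0"
  obtains \<phi> where "Vector_Spaces.linear s (*) \<phi>" "\<phi> d \<noteq> 0"
proof -
  interpret V: vector_space s by fact
  interpret K: vector_space "(*) :: 'k \<Rightarrow> 'k \<Rightarrow> 'k" by (rule vector_space_ground)
  interpret vector_space_pair s "(*)" by unfold_locales
  have "V.independent {d}" using assms(2) by (simp add: V.independent_insert)
  from linear_independent_extend[OF this, of "\<lambda>_. 1"] show ?thesis
    using that by auto
qed

lemma tens_sum_list_eval: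
  assumes "bilinear_map U V ground \<beta>"
  shows "sum_list (map (\<lambda>(x, y). tens U V x y) ps) \<beta> = sum_list (map (\<lambda>(x, y). \<beta> x y) ps)"
  using assms by (induction ps) (auto simp: tens_def)

lemma tensor_eq_imp:
  fixes f :: "'u::ab_group_add \<Rightarrow> 'v::ab_group_add \<Rightarrow> 'w::ab_group_add"
  assumes W: "is_vspace W" and f: "bilinear_map U V W f"
    and eq: "sum_list (map (\<lambda>(x, y). tens U V x y) ps) = sum_list (map (\<lambda>(x, y). tens U V x y) qs)"
  shows "sum_list (map (\<lambda>(x, y). f x y) ps) = sum_list (map (\<lambda>(x, y). f x y) qs)" (is "?l = ?r")
proof (rule ccontr)
  assume "?l \<noteq> ?r"
  then have "?l - ?r \<noteq> 0" by simp
  moreover have "vector_space (vscale W)" using W by (simp add: is_vspace_def)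
  ultimately obtain \<phi> where \<phi>: "Vector_Spaces.linear (vscale W) (*) \<phi>" "\<phi> (?l - ?r) \<noteq> 0"
    using separating_functional by blast
  interpret \<phi>: Vector_Spaces.linear "vscale W" "(*)" \<phi> by fact
  have "bilinear_map U V ground (\<lambda>x y. \<phi> (f x y))"
    using f by (auto simp: bilinear_map_def linear_map_def ground_def \<phi>.add \<phi>.scale)
  note eval = tens_sum_list_eval[OF this]
  have "sum_list (map (\<lambda>(x, y). \<phi> (f x y)) ps) = sum_list (map (\<lambda>(x, y). \<phi> (f x y)) qs)"
    using eval[of ps] eval[of qs] unfolding eq by simp
  moreover have "\<phi> (sum_list (map (\<lambda>(x, y). f x y) zs)) = sum_list (map (\<lambda>(x, y). \<phi> (f x y)) zs)"
    for zs by (induction zs) (auto simp: \<phi>.add)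
  ultimately show False using \<phi>(2) by (simp add: \<phi>.diff)
qed

lemma tlift_sum:
  assumes "is_vspace W" "bilinear_map U V W f" "set ps \<subseteq> vcarrier U \<times> vcarrier V"
  shows "tlift U V f (sum_list (map (\<lambda>(x, y). tens U V x y) ps)) = sum_list (map (\<lambda>(x, y). f x y) ps)"
proof -
  let ?P = "\<lambda>qs. set qs \<subseteq> vcarrier U \<times> vcarrier V \<and>
    sum_list (map (\<lambda>(x, y). tens U V x y) ps) = sum_list (map (\<lambda>(x, y). tens U V x y) qs)"
  have "?P (SOME qs. ?P qs)" by (rule someI[of ?P ps]) (use assms in simp)
  then show ?thesis
    unfolding tlift_def Let_def by (intro tensor_eq_imp[OF assms(1,2), symmetric]) (rule conjunct2)
qed

theorem tensor_universal:
  assumes U: "is_vspace U" and W: "is_vspace W" and f: "bilinear_map U V W f"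
  shows "linear_map (tensor_prod U V) W (tlift U V f)"
    and "\<lbrakk>x \<in> vcarrier U; y \<in> vcarrier V\<rbrakk> \<Longrightarrow> tlift U V f (tens U V x y) = f x y"
    and "\<lbrakk>linear_map (tensor_prod U V) W g;
          \<And>x y. \<lbrakk>x \<in> vcarrier U; y \<in> vcarrier V\<rbrakk> \<Longrightarrow> g (tens U V x y) = f x y;
          t \<in> vcarrier (tensor_prod U V)\<rbrakk> \<Longrightarrow> g t = tlift U V f t"
proof -
  interpret T: vector_space tensor_scale by (rule vector_space_tensor_scale)
  interpret U: vector_space "vscale U" using U by (simp add: is_vspace_def)
  interpret W: vector_space "vscale W" using W by (simp add: is_vspace_def)
  have subU: "U.subspace (vcarrier U)" and subW: "W.subspace (vcarrier W)"
    using U W by (simp_all add: is_vspace_def)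
  have T: "vscale (tensor_prod U V) = tensor_scale" by (simp add: tensor_prod_def)
  note lift = tlift_sum[OF W f] and rep = tensor_prod_carrier_iff[OF U, of _ V]
  let ?t = "\<lambda>ps. sum_list (map (\<lambda>(x, y). tens U V x y) ps)"
  let ?f = "\<lambda>ps. sum_list (map (\<lambda>(x, y). f x y) ps)"
  let ?C = "vcarrier U \<times> vcarrier V"
  let ?s = "\<lambda>c. map (\<lambda>(x, y). (vscale U c x, y))"
  have in_W: "?f ps \<in> vcarrier W" if "set ps \<subseteq> ?C" for ps
    using that f
    by (induction ps)
       (auto intro!: W.subspace_add[OF subW] W.subspace_0[OF subW] simp: bilinear_map_def linear_map_def)
  have s_C: "set (?s c ps) \<subseteq> ?C" if "set ps \<subseteq> ?C" for c ps
    using that U.subspace_scale[OF subU] by auto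
  have s_t: "?t (?s c ps) = tensor_scale c (?t ps)" if "set ps \<subseteq> ?C" for c ps
    using that bilinear_tens[of U V]
    by (induction ps) (auto simp: T.scale_right_distrib bilinear_map_def linear_map_def T)
  have s_f: "?f (?s c ps) = vscale W c (?f ps)" if "set ps \<subseteq> ?C" for c ps
    using that f
    by (induction ps) (auto simp: W.scale_right_distrib bilinear_map_def linear_map_def)
  show "linear_map (tensor_prod U V) W (tlift U V f)"
    unfolding linear_map_def T
  proof (intro conjI ballI allI)
    fix t u c
    assume t: "t \<in> vcarrier (tensor_prod U V)"
    then obtain ps where ps: "set ps \<subseteq> ?C" "t = ?t ps" unfolding rep by blast
    show "tlift U V f t \<in> vcarrier W" using in_W lift ps by simp
    show "tlift U V f (tensor_scale c t) = vscale W c (tlift U V f t)"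
      using lift[OF s_C[OF ps(1), of c]] lift[OF ps(1)]
      unfolding s_t[OF ps(1)] s_f[OF ps(1)] ps(2) by simp
    assume "u \<in> vcarrier (tensor_prod U V)"
    then obtain qs where qs: "set qs \<subseteq> ?C" "u = ?t qs" unfolding rep by blast
    show "tlift U V f (t + u) = tlift U V f t + tlift U V f u"
      using lift[of "ps @ qs"] lift[OF ps(1)] lift[OF qs(1)] ps qs by simp
  qed
  show "tlift U V f (tens U V x y) = f x y" if "x \<in> vcarrier U" "y \<in> vcarrier V"
    using lift[of "[(x, y)]"] that by simp
  show "g t = tlift U V f t"
    if g: "linear_map (tensor_prod U V) W g"
      "\<And>x y. \<lbrakk>x \<in> vcarrier U; y \<in> vcarrier V\<rbrakk> \<Longrightarrow> g (tens U V x y) = f x y"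
      and t: "t \<in> vcarrier (tensor_prod U V)"
  proof -
    obtain ps where ps: "set ps \<subseteq> ?C" "t = ?t ps" using t unfolding rep by blast
    have "g 0 = 0"
    proof -
      have zero: "0 \<in> vcarrier (tensor_prod U V)" by (simp add: tensor_prod_def T.span_zero)
      have "g (0 + 0) = g 0 + g 0"
        using g(1) zero unfolding linear_map_def by blast
      then show ?thesis by simp
    qed
    moreover have "?t zs \<in> vcarrier (tensor_prod U V)" if "set zs \<subseteq> ?C" for zs
      using rep that by blast
    ultimately have "g (?t zs) = ?f zs" if "set zs \<subseteq> ?C" for zs
      using that g by (induction zs) (auto simp: linear_map_def tens_in_tensor_prod)
    then show ?thesis using lift ps by simp
  qed
qed


section \<open>Bialgebras, comodules and Yetter--Drinfeld modules\<close>

text \<open>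
  The algebra is the whole type \<open>'a\<close> with the ring operations of its class. This class demands
  \<open>0 \<noteq> 1\<close>, which holds in every bialgebra because the counit maps \<open>1\<close> to \<open>1\<close>.
\<close>

record ('k, 'a) bialg = "('k, 'a) vspace" +
  comult :: "'a \<Rightarrow> ('k, 'a, 'a) tensor"
  counit :: "'a \<Rightarrow> 'k"

definition unital_algebra :: "('k::field, 'a::ring_1, 'z) vspace_scheme \<Rightarrow> bool" where
  "unital_algebra A \<longleftrightarrow> is_vspace A \<and> vcarrier A = UNIV \<and> bilinear_map A A A (*)"

definition coalgebra :: "('k::field, 'a::ab_group_add, 'z) bialg_scheme \<Rightarrow> bool" where
  "coalgebra A \<longleftrightarrow>
     is_vspace A \<and>
     linear_map A (tensor_prod A A) (comult A) \<and>
     linear_map A ground (counit A) \<and>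
     (\<forall>a\<in>vcarrier A.
        tlift A A (\<lambda>x y. tlift A A (\<lambda>u v. tens A (tensor_prod A A) u (tens A A v y)) (comult A x))
          (comult A a)
        = tlift A A (\<lambda>x y. tens A (tensor_prod A A) x (comult A y)) (comult A a)) \<and>
     (\<forall>a\<in>vcarrier A. tlift A A (\<lambda>x y. vscale A (counit A x) y) (comult A a) = a) \<and>
     (\<forall>a\<in>vcarrier A. tlift A A (\<lambda>x y. vscale A (counit A y) x) (comult A a) = a)"

definition bialgebra :: "('k::field, 'a::ring_1, 'z) bialg_scheme \<Rightarrow> bool" where
  "bialgebra A \<longleftrightarrow>
     unital_algebra A \<and> coalgebra A \<and>
     (\<forall>a b. comult A (a * b) =
        tlift A A (\<lambda>x y. tlift A A (\<lambda>u v. tens A A (x * u) (y * v)) (comult A b)) (comult A a)) \<and>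
     comult A 1 = tens A A 1 1 \<and>
     (\<forall>a b. counit A (a * b) = counit A a * counit A b) \<and>
     counit A 1 = 1"

record ('k, 'm, 'a) comod = "('k, 'm) vspace" +
  coact :: "'m \<Rightarrow> ('k, 'm, 'a) tensor"

definition right_comodule ::
  "('k::field, 'a::ring_1, 'y) bialg_scheme \<Rightarrow> ('k, 'm::ab_group_add, 'a, 'z) comod_scheme
    \<Rightarrow> bool" where
  "right_comodule A M \<longleftrightarrow>
     is_vspace M \<and>
     linear_map M (tensor_prod M A) (coact M) \<and>
     (\<forall>m\<in>vcarrier M.
        tlift M A (\<lambda>n b. tlift M A (\<lambda>p c. tens M (tensor_prod A A) p (tens A A c b)) (coact M n))
          (coact M m)
        = tlift M A (\<lambda>n b. tens M (tensor_prod A A) n (comult A b)) (coact M m)) \<and>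
     (\<forall>m\<in>vcarrier M. tlift M A (\<lambda>n b. vscale M (counit A b) n) (coact M m) = m)"

definition right_module ::
  "('k::field, 'a::ring_1, 'y) vspace_scheme \<Rightarrow> ('k, 'm::ab_group_add, 'z) vspace_scheme
    \<Rightarrow> ('m \<Rightarrow> 'a \<Rightarrow> 'm) \<Rightarrow> bool" where
  "right_module A M act \<longleftrightarrow>
     is_vspace M \<and>
     bilinear_map M A M act \<and>
     (\<forall>m\<in>vcarrier M. act m 1 = m) \<and>
     (\<forall>m\<in>vcarrier M. \<forall>a b. act (act m a) b = act m (a * b))"

definition yetter_drinfeld ::
  "('k::field, 'a::ring_1, 'y) bialg_scheme \<Rightarrow> ('k, 'm::ab_group_add, 'a, 'z) comod_scheme
    \<Rightarrow> ('m \<Rightarrow> 'a \<Rightarrow> 'm) \<Rightarrow> bool" where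
  "yetter_drinfeld A M act \<longleftrightarrow>
     right_module A M act \<and>
     right_comodule A M \<and>
     (\<forall>m\<in>vcarrier M. \<forall>a.
        tlift M A (\<lambda>m0 m1. tlift A A (\<lambda>a1 a2. tens M A (act m0 a1) (m1 * a2)) (comult A a))
          (coact M m)
        = tlift A A (\<lambda>a1 a2. tlift M A (\<lambda>n0 n1. tens M A n0 (a1 * n1)) (coact M (act m a2)))
            (comult A a))"

definition coefficient_coalgebra ::
  "('k::field, 'a::ring_1, 'y) bialg_scheme \<Rightarrow> ('k, 'm::ab_group_add, 'a, 'z) comod_scheme
    \<Rightarrow> 'a set" where
  "coefficient_coalgebra A M =
     module.span (vscale A)
       {tlift M A (\<lambda>m0 m1. vscale A (\<phi> m0) m1) (coact M m) |m \<phi>.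
          m \<in> vcarrier M \<and> linear_map M ground \<phi>}"


section \<open>Universal r-forms\<close>

definition linear_functional2 ::
  "('k::field, 'a::ring_1, 'z) bialg_scheme \<Rightarrow> (('k, 'a, 'a) tensor \<Rightarrow> 'k) \<Rightarrow> bool" where
  "linear_functional2 A r \<longleftrightarrow> linear_map (tensor_prod A A) ground r"

text \<open>
  The convolution product of functionals on the tensor product coalgebra \<open>A \<otimes> A\<close>, evaluated at
  \<open>a \<otimes> b\<close>; its neutral element is \<open>a \<otimes> b \<mapsto> \<epsilon>(a) \<epsilon>(b)\<close>.
\<close>

definition convolution2 ::
  "('k::field, 'a::ring_1, 'z) bialg_scheme \<Rightarrow> (('k, 'a, 'a) tensor \<Rightarrow> 'k)
    \<Rightarrow> (('k, 'a, 'a) tensor \<Rightarrow> 'k) \<Rightarrow> 'a \<Rightarrow> 'a \<Rightarrow> 'k" where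
  "convolution2 A f g a b =
     tlift A A (\<lambda>a1 a2. tlift A A (\<lambda>b1 b2. f (tens A A a1 b1) * g (tens A A a2 b2)) (comult A b))
       (comult A a)"

definition is_convolution_inverse ::
  "('k::field, 'a::ring_1, 'z) bialg_scheme \<Rightarrow> (('k, 'a, 'a) tensor \<Rightarrow> 'k)
    \<Rightarrow> (('k, 'a, 'a) tensor \<Rightarrow> 'k) \<Rightarrow> bool" where
  "is_convolution_inverse A r s \<longleftrightarrow>
     linear_functional2 A s \<and>
     (\<forall>a b. convolution2 A r s a b = counit A a * counit A b) \<and>
     (\<forall>a b. convolution2 A s r a b = counit A a * counit A b)"

definition convolution_invertible ::
  "('k::field, 'a::ring_1, 'z) bialg_scheme \<Rightarrow> (('k, 'a, 'a) tensor \<Rightarrow> 'k) \<Rightarrow> bool" where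
  "convolution_invertible A r \<longleftrightarrow> (\<exists>s. is_convolution_inverse A r s)"

text \<open>The inverse is unique on \<open>A \<otimes> A\<close>; the choice only concerns values outside that space.\<close>

definition convolution_inverse ::
  "('k::field, 'a::ring_1, 'z) bialg_scheme \<Rightarrow> (('k, 'a, 'a) tensor \<Rightarrow> 'k)
    \<Rightarrow> ('k, 'a, 'a) tensor \<Rightarrow> 'k" where
  "convolution_inverse A r = (SOME s. is_convolution_inverse A r s)"

definition universal_r_form ::
  "('k::field, 'a::ring_1, 'z) bialg_scheme \<Rightarrow> (('k, 'a, 'a) tensor \<Rightarrow> 'k) \<Rightarrow> bool" where
  "universal_r_form A r \<longleftrightarrow>
     linear_functional2 A r \<and> convolution_invertible A r \<and>
     (\<forall>a b c. r (tens A A c (a * b)) =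
        tlift A A (\<lambda>c1 c2. r (tens A A c1 b) * r (tens A A c2 a)) (comult A c)) \<and>
     (\<forall>a b c. r (tens A A (a * b) c) =
        tlift A A (\<lambda>c1 c2. r (tens A A a c1) * r (tens A A b c2)) (comult A c)) \<and>
     (\<forall>a b.
        tlift A A (\<lambda>a1 a2. tlift A A (\<lambda>b1 b2. vscale A (r (tens A A a1 b1)) (a2 * b2))
          (comult A b)) (comult A a)
        = tlift A A (\<lambda>a1 a2. tlift A A (\<lambda>b1 b2. vscale A (r (tens A A a2 b2)) (b1 * a1))
          (comult A b)) (comult A a))"

definition act1 ::
  "('k::field, 'a::ring_1, 'y) bialg_scheme \<Rightarrow> (('k, 'a, 'a) tensor \<Rightarrow> 'k)
    \<Rightarrow> ('k, 'm::ab_group_add, 'a, 'z) comod_scheme \<Rightarrow> 'm \<Rightarrow> 'a \<Rightarrow> 'm" where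
  "act1 A r M m a = tlift M A (\<lambda>m0 m1. vscale M (r (tens A A m1 a)) m0) (coact M m)"

definition act2 ::
  "('k::field, 'a::ring_1, 'y) bialg_scheme \<Rightarrow> (('k, 'a, 'a) tensor \<Rightarrow> 'k)
    \<Rightarrow> ('k, 'm::ab_group_add, 'a, 'z) comod_scheme \<Rightarrow> 'm \<Rightarrow> 'a \<Rightarrow> 'm" where
  "act2 A r M m a =
     tlift M A (\<lambda>m0 m1. vscale M (convolution_inverse A r (tens A A a m1)) m0) (coact M m)"

end

theory Submission imports Defs
begin

text \<open>
  Everything in the theorem is a statement about the two bilinear forms \<open>\<kappa>(a, c) = r(c \<otimes> a)\<close> and
  \<open>\<kappa>(a, c) = s(a \<otimes> c)\<close>, where \<open>s\<close> is the convolution inverse of \<open>r\<close>. Both actions have the shape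
  \<open>m \<triangleleft> a = \<kappa>(a, m\<^sub>1) m\<^sub>0\<close>, so they can be treated together.

  Coassociativity of a comodule \<open>M\<close> rewrites each side of each Yetter--Drinfeld axiom for this action
  as \<open>m\<^sub>0 \<otimes> F(m\<^sub>1)\<close> with \<open>F\<close> linear on \<open>A\<close>. If two such maps \<open>F\<close>, \<open>G\<close> agree, the axiom holds;
  conversely, applying a functional \<open>\<phi>\<close> of \<open>M\<close> to the first factor turns the axiom into \<open>F = G\<close> at
  the matrix coefficient \<open>\<phi>(m\<^sub>0) m\<^sub>1\<close>. As matrix coefficients span \<open>A\<close>, the axioms for all \<open>M\<close> in the
  family amount to three identities on \<open>A\<close>, named \<open>braiding \<kappa>\<close> below: \<open>\<kappa>(1, c) = \<epsilon>(c)\<close>,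
  \<open>\<kappa>(ab, c) = \<kappa>(b, c\<^sub>1) \<kappa>(a, c\<^sub>2)\<close> and
  \<open>\<kappa>(a\<^sub>1, c\<^sub>1) c\<^sub>2 a\<^sub>2 = \<kappa>(a\<^sub>2, c\<^sub>2) a\<^sub>1 c\<^sub>1\<close>
  (\<open>yetter_drinfeld_family_iff_braiding\<close>).

  It remains to see that \<open>r\<close> is a universal r-form iff both forms are braiding
  (\<open>universal_r_form_iff_braiding\<close>). For \<open>r(c \<otimes> a)\<close> the last two identities are (CQT.1) and (CQT.3)
  word for word. For \<open>s\<close> they are (CQT.2) and (CQT.3) inverted: regard \<open>a \<mapsto> r(a \<otimes> -)\<close> and
  \<open>a \<mapsto> s(a \<otimes> -)\<close> as mutually inverse elements of the convolution algebra of linear maps from \<open>A\<close> to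
  its dual algebra. (CQT.2) says that the first map is multiplicative, which is equivalent to the
  second being antimultiplicative, just as the antipode, the inverse of the identity, is
  antimultiplicative. (CQT.3) says that \<open>r\<close> intertwines the multiplication of \<open>A\<close> with its opposite,
  and multiplying by \<open>s\<close> from both sides gives the version for \<open>s\<close>. The unit identities follow because
  an invertible idempotent is the unit.
\<close>

section \<open>Linear maps and Sweedler sums\<close>

lemma vspace_closed:
  assumes "is_vspace V"
  shows "0 \<in> vcarrier V"
    and "\<lbrakk>x \<in> vcarrier V; y \<in> vcarrier V\<rbrakk> \<Longrightarrow> x + y \<in> vcarrier V"
    and "x \<in> vcarrier V \<Longrightarrow> vscale V c x \<in> vcarrier V"
proof -
  interpret vector_space "vscale V" using assms by (simp add: is_vspace_def)
  have "subspace (vcarrier V)" using assms by (simp add: is_vspace_def)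
  then show "0 \<in> vcarrier V"
    "\<lbrakk>x \<in> vcarrier V; y \<in> vcarrier V\<rbrakk> \<Longrightarrow> x + y \<in> vcarrier V"
    "x \<in> vcarrier V \<Longrightarrow> vscale V c x \<in> vcarrier V"
    by (simp_all add: subspace_0 subspace_add subspace_scale)
qed

lemma vspace_scale:
  assumes "is_vspace V"
  shows "vscale V c (x + y) = vscale V c x + vscale V c y"
    and "vscale V (c + d) x = vscale V c x + vscale V d x"
    and "vscale V c (vscale V d x) = vscale V (c * d) x"
    and "vscale V 1 x = x"
    and "vscale V c 0 = 0"
proof -
  interpret vector_space "vscale V" using assms by (simp add: is_vspace_def)
  show "vscale V c (x + y) = vscale V c x + vscale V c y"
    "vscale V (c + d) x = vscale V c x + vscale V d x"
    "vscale V c (vscale V d x) = vscale V (c * d) x" "vscale V 1 x = x" "vscale V c 0 = 0"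
    by (simp_all add: scale_right_distrib scale_left_distrib)
qed

lemma ground_simps [simp]: "vcarrier ground = UNIV" "vscale ground = (*)"
  by (simp_all add: ground_def)

lemma linear_mapD:
  assumes "linear_map V W f"
  shows "x \<in> vcarrier V \<Longrightarrow> f x \<in> vcarrier W"
    and "\<lbrakk>x \<in> vcarrier V; y \<in> vcarrier V\<rbrakk> \<Longrightarrow> f (x + y) = f x + f y"
    and "x \<in> vcarrier V \<Longrightarrow> f (vscale V c x) = vscale W c (f x)"
  using assms by (auto simp: linear_map_def)

lemma bilinear_mapD:
  assumes "bilinear_map U V W f"
  shows "x \<in> vcarrier U \<Longrightarrow> linear_map V W (f x)"
    and "y \<in> vcarrier V \<Longrightarrow> linear_map U W (\<lambda>x. f x y)"
  using assms by (auto simp: bilinear_map_def)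

lemma linear_map_0:
  assumes "is_vspace V" "linear_map V W f"
  shows "f 0 = 0"
proof -
  have "f (0 + 0) = f 0 + f 0"
    using assms vspace_closed(1) by (blast dest: linear_mapD(2))
  then show ?thesis by simp
qed

lemma linear_map_comp:
  assumes "linear_map V W g" "linear_map U V f"
  shows "linear_map U W (\<lambda>x. g (f x))"
  using assms by (auto simp: linear_map_def)

lemma bilinear_map_comp:
  assumes "bilinear_map V V' W p" "linear_map U V f" "linear_map U' V' g"
  shows "bilinear_map U U' W (\<lambda>x y. p (f x) (g y))"
  using assms by (auto simp: linear_map_def bilinear_map_def)

lemma linear_map_scale:
  assumes "is_vspace W" "linear_map U ground f" "w \<in> vcarrier W"
  shows "linear_map U W (\<lambda>x. vscale W (f x) w)"
  using assms by (auto simp: linear_map_def vspace_closed vspace_scale)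

lemma bilinear_map_scale: "is_vspace W \<Longrightarrow> bilinear_map ground W W (vscale W)"
  by (auto simp: bilinear_map_def linear_map_def vspace_closed vspace_scale mult.commute)

text \<open>
  The point of naming the list of pure tensors chosen in \<open>tlift\<close> is that it depends only on the tensor,
  not on the integrand. Hence sums over it can be exchanged and additive maps can be moved through
  them whether or not the integrand is bilinear.
\<close>

definition tensor_rep ::
  "('k::field, 'u::ab_group_add, 'y) vspace_scheme \<Rightarrow> ('k, 'v::ab_group_add, 'z) vspace_scheme
    \<Rightarrow> ('k, 'u, 'v) tensor \<Rightarrow> ('u \<times> 'v) list" where
  "tensor_rep U V t =
     (SOME ps. set ps \<subseteq> vcarrier U \<times> vcarrier V \<and>
               t = sum_list (map (\<lambda>(x, y). tens U V x y) ps))"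

lemma tlift_rep: "tlift U V f t = (\<Sum>(x, y)\<leftarrow>tensor_rep U V t. f x y)"
  by (simp add: tlift_def tensor_rep_def)

lemma set_tensor_rep:
  assumes "is_vspace U" "t \<in> vcarrier (tensor_prod U V)"
  shows "set (tensor_rep U V t) \<subseteq> vcarrier U \<times> vcarrier V"
proof -
  from assms obtain ps where "set ps \<subseteq> vcarrier U \<times> vcarrier V \<and>
      t = sum_list (map (\<lambda>(x, y). tens U V x y) ps)"
    using tensor_prod_carrier_iff by blast
  then show ?thesis unfolding tensor_rep_def by (rule someI2) blast
qed

lemma tlift_add:
  "tlift U V (\<lambda>x y. f x y + g x y) t = tlift U V f t + tlift U V g t"
proof -
  have "(\<Sum>(x, y)\<leftarrow>ps. f x y + g x y) = (\<Sum>(x, y)\<leftarrow>ps. f x y) + (\<Sum>(x, y)\<leftarrow>ps. g x y)" for ps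
    by (induction ps) (auto simp: algebra_simps)
  then show ?thesis by (simp add: tlift_rep)
qed

lemma additive_tlift:
  assumes "\<And>x y. h (x + y) = h x + h y"
  shows "h (tlift U V f t) = tlift U V (\<lambda>x y. h (f x y)) t"
proof -
  have "h (0 + 0) = h 0 + h 0" by (rule assms)
  then have "h 0 = 0" by simp
  then have "h (\<Sum>(x, y)\<leftarrow>ps. f x y) = (\<Sum>(x, y)\<leftarrow>ps. h (f x y))" for ps
    by (induction ps) (auto simp: assms)
  then show ?thesis by (simp add: tlift_rep)
qed

lemma tlift_apply: "tlift U V f t z = tlift U V (\<lambda>x y. f x y z) t"
  by (rule additive_tlift[of "\<lambda>h. h z"]) simp

lemma vscale_tlift:
  "is_vspace W \<Longrightarrow> vscale W c (tlift U V f t) = tlift U V (\<lambda>x y. vscale W c (f x y)) t"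
  by (rule additive_tlift) (rule vspace_scale)

lemma tlift_swap:
  "tlift U V (\<lambda>x y. tlift X Y (f x y) s) t = tlift X Y (\<lambda>u v. tlift U V (\<lambda>x y. f x y u v) t) s"
proof -
  have *: "tlift X Y (\<lambda>u v. 0) s = 0"
    by (rule additive_tlift[of "\<lambda>_. 0", symmetric]) simp
  have "(\<Sum>(x, y)\<leftarrow>ps. tlift X Y (f x y) s) = tlift X Y (\<lambda>u v. \<Sum>(x, y)\<leftarrow>ps. f x y u v) s" for ps
    by (induction ps) (auto simp: * tlift_add)
  then show ?thesis unfolding tlift_rep[of U V] .
qed

lemma tlift_cong:
  assumes "is_vspace U" "t \<in> vcarrier (tensor_prod U V)"
    and "\<And>x y. \<lbrakk>x \<in> vcarrier U; y \<in> vcarrier V\<rbrakk> \<Longrightarrow> f x y = g x y"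
  shows "tlift U V f t = tlift U V g t"
  unfolding tlift_rep
  by (rule arg_cong[where f = sum_list], rule map_cong) (use set_tensor_rep[OF assms(1,2)] assms(3) in auto)

lemma tlift_closed:
  assumes "is_vspace U" "t \<in> vcarrier (tensor_prod U V)" "is_vspace W"
    and "\<And>x y. \<lbrakk>x \<in> vcarrier U; y \<in> vcarrier V\<rbrakk> \<Longrightarrow> f x y \<in> vcarrier W"
  shows "tlift U V f t \<in> vcarrier W"
proof -
  have "(\<Sum>(x, y)\<leftarrow>ps. f x y) \<in> vcarrier W" if "set ps \<subseteq> vcarrier U \<times> vcarrier V" for ps
    using that by (induction ps) (auto simp: vspace_closed assms(3,4))
  then show ?thesis unfolding tlift_rep using set_tensor_rep[OF assms(1,2)] .
qed

lemma linear_map_tlift: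
  assumes "is_vspace U" "t \<in> vcarrier (tensor_prod U V)" "is_vspace W" "linear_map W X h"
    and "\<And>x y. \<lbrakk>x \<in> vcarrier U; y \<in> vcarrier V\<rbrakk> \<Longrightarrow> f x y \<in> vcarrier W"
  shows "h (tlift U V f t) = tlift U V (\<lambda>x y. h (f x y)) t"
proof -
  have "(\<Sum>(x, y)\<leftarrow>ps. f x y) \<in> vcarrier W \<and>
      h (\<Sum>(x, y)\<leftarrow>ps. f x y) = (\<Sum>(x, y)\<leftarrow>ps. h (f x y))"
    if "set ps \<subseteq> vcarrier U \<times> vcarrier V" for ps
    using that
    by (induction ps)
       (auto simp: vspace_closed assms linear_map_0[OF assms(3,4)] linear_mapD(2)[OF assms(4)])
  then show ?thesis unfolding tlift_rep using set_tensor_rep[OF assms(1,2)] by blast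
qed

lemma linear_map_tlift_integrand:
  assumes "is_vspace U" "t \<in> vcarrier (tensor_prod U V)" "is_vspace X"
    and f: "\<And>x y. \<lbrakk>x \<in> vcarrier U; y \<in> vcarrier V\<rbrakk> \<Longrightarrow> linear_map W X (\<lambda>z. f z x y)"
  shows "linear_map W X (\<lambda>z. tlift U V (f z) t)"
  unfolding linear_map_def
proof (intro conjI ballI allI)
  fix z w c assume z: "z \<in> vcarrier W"
  show "tlift U V (f z) t \<in> vcarrier X"
    by (rule tlift_closed[OF assms(1-3)]) (rule linear_mapD(1)[OF f z])
  show "tlift U V (f (vscale W c z)) t = vscale X c (tlift U V (f z) t)"
    unfolding vscale_tlift[OF assms(3)]
    by (rule tlift_cong[OF assms(1,2)]) (rule linear_mapD(3)[OF f z])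
  assume w: "w \<in> vcarrier W"
  show "tlift U V (f (z + w)) t = tlift U V (f z) t + tlift U V (f w) t"
    unfolding tlift_add[symmetric]
    by (rule tlift_cong[OF assms(1,2)]) (rule linear_mapD(2)[OF f z w])
qed

text \<open>
  One statement serves the coalgebra and its comodules. It results from applying the linear map on
  \<open>M \<otimes> (A \<otimes> A)\<close> induced by \<open>B\<close> to both sides of coassociativity.
\<close>

lemma tlift_coassoc:
  assumes M: "is_vspace M" "linear_map M (tensor_prod M A) \<delta>" and A: "is_vspace A" "linear_map A (tensor_prod A A) \<Delta>"
    and X: "is_vspace X" and B: "bilinear_map M (tensor_prod A A) X B"
    and m: "m \<in> vcarrier M"
    and eq: "tlift M A (\<lambda>n b. tlift M A (\<lambda>p c. tens M (tensor_prod A A) p (tens A A c b)) (\<delta> n)) (\<delta> m)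
        = tlift M A (\<lambda>n b. tens M (tensor_prod A A) n (\<Delta> b)) (\<delta> m)"
  shows "tlift M A (\<lambda>n b. tlift M A (\<lambda>p c. B p (tens A A c b)) (\<delta> n)) (\<delta> m)
        = tlift M A (\<lambda>n b. B n (\<Delta> b)) (\<delta> m)"
proof -
  let ?AA = "tensor_prod A A"
  let ?L = "tlift M ?AA B"
  have L: "linear_map (tensor_prod M ?AA) X ?L"
    and L_tens: "\<And>x y. \<lbrakk>x \<in> vcarrier M; y \<in> vcarrier ?AA\<rbrakk> \<Longrightarrow> ?L (tens M ?AA x y) = B x y"
    using tensor_universal(1,2)[OF M(1) X B] by blast+
  have \<delta>: "\<delta> n \<in> vcarrier (tensor_prod M A)" if "n \<in> vcarrier M" for n
    using linear_mapD(1)[OF M(2) that] .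
  have \<Delta>: "\<Delta> n \<in> vcarrier (tensor_prod A A)" if "n \<in> vcarrier A" for n
    using linear_mapD(1)[OF A(2) that] .
  have inner: "?L (tlift M A (\<lambda>p c. tens M ?AA p (tens A A c b)) (\<delta> n)) =
      tlift M A (\<lambda>p c. B p (tens A A c b)) (\<delta> n)"
    if n: "n \<in> vcarrier M" and b: "b \<in> vcarrier A" for n b
    by (subst linear_map_tlift[OF M(1) \<delta>[OF n] is_vspace_tensor_prod L])
       (auto intro!: tens_in_tensor_prod b tlift_cong[OF M(1) \<delta>[OF n]] L_tens)
  have "tlift M A (\<lambda>n b. tlift M A (\<lambda>p c. B p (tens A A c b)) (\<delta> n)) (\<delta> m) =
     tlift M A (\<lambda>n b. ?L (tlift M A (\<lambda>p c. tens M ?AA p (tens A A c b)) (\<delta> n))) (\<delta> m)"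
    by (rule tlift_cong[OF M(1) \<delta>[OF m]]) (simp add: inner)
  also have "\<dots> = ?L (tlift M A (\<lambda>n b. tlift M A (\<lambda>p c. tens M ?AA p (tens A A c b)) (\<delta> n)) (\<delta> m))"
    by (subst linear_map_tlift[OF M(1) \<delta>[OF m] is_vspace_tensor_prod L])
       (auto intro!: tens_in_tensor_prod tlift_closed[OF M(1) \<delta>] is_vspace_tensor_prod)
  also have "\<dots> = ?L (tlift M A (\<lambda>n b. tens M ?AA n (\<Delta> b)) (\<delta> m))"
    by (simp only: eq)
  also have "\<dots> = tlift M A (\<lambda>n b. B n (\<Delta> b)) (\<delta> m)"
    by (subst linear_map_tlift[OF M(1) \<delta>[OF m] is_vspace_tensor_prod L])
       (auto intro!: tens_in_tensor_prod \<Delta> tlift_cong[OF M(1) \<delta>[OF m]] L_tens)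
  finally show ?thesis .
qed

section \<open>Convolution algebras\<close>

text \<open>
  Unital associative algebras on a carrier, with the product as an explicit argument: the class of
  rings does not suffice because convolution products on function spaces are iterated, and they are
  associative and unital on linear maps only.
\<close>

definition unital_assoc ::
  "('k::field, 'b::ab_group_add, 'z) vspace_scheme \<Rightarrow> ('b \<Rightarrow> 'b \<Rightarrow> 'b) \<Rightarrow> 'b \<Rightarrow> bool" where
  "unital_assoc B p u \<longleftrightarrow>
     is_vspace B \<and> bilinear_map B B B p \<and> u \<in> vcarrier B \<and>
     (\<forall>x\<in>vcarrier B. p u x = x \<and> p x u = x) \<and>
     (\<forall>x\<in>vcarrier B. \<forall>y\<in>vcarrier B. \<forall>z\<in>vcarrier B. p (p x y) z = p x (p y z))"

lemma unital_assocD: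
  assumes "unital_assoc B p u"
  shows "is_vspace B" "bilinear_map B B B p" "u \<in> vcarrier B"
    and "x \<in> vcarrier B \<Longrightarrow> p u x = x" "x \<in> vcarrier B \<Longrightarrow> p x u = x"
    and "\<lbrakk>x \<in> vcarrier B; y \<in> vcarrier B; z \<in> vcarrier B\<rbrakk> \<Longrightarrow> p (p x y) z = p x (p y z)"
    and "\<lbrakk>x \<in> vcarrier B; y \<in> vcarrier B\<rbrakk> \<Longrightarrow> p x y \<in> vcarrier B"
  using assms by (auto simp: unital_assoc_def bilinear_map_def linear_map_def)

lemma left_inverse_eq_right_inverse:
  assumes B: "unital_assoc B p u" and "x \<in> vcarrier B" "y \<in> vcarrier B" "z \<in> vcarrier B"
    and "p x z = u" "p z y = u"
  shows "x = y"
  using unital_assocD(4,5)[OF B] unital_assocD(6)[OF B, of x z y] assms(2-) by metis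

text \<open>Multiply the first equation by \<open>y\<close> from both sides, or the second by \<open>x\<close>.\<close>

lemma intertwiner_inverse:
  assumes B: "unital_assoc B p u" and el: "x \<in> vcarrier B" "y \<in> vcarrier B" "f \<in> vcarrier B" "g \<in> vcarrier B"
    and inv: "p x y = u" "p y x = u"
  shows "p x f = p g x \<longleftrightarrow> p f y = p y g"
proof
  note assoc = unital_assocD(6)[OF B] and closed = unital_assocD(7)[OF B] and unit = unital_assocD(4,5)[OF B]
  assume *: "p x f = p g x"
  have "p f y = p (p y (p x f)) y" using inv unit assoc[of y x f] el closed by simp
  also have "\<dots> = p y (p g (p x y))" using * assoc el closed by simp
  also have "\<dots> = p y g" using inv unit el by simp
  finally show "p f y = p y g" .
next
  note assoc = unital_assocD(6)[OF B] and closed = unital_assocD(7)[OF B] and unit = unital_assocD(4,5)[OF B]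
  assume *: "p f y = p y g"
  have "p x f = p x (p (p f y) x)" using inv unit assoc[of f y x] el closed by simp
  also have "\<dots> = p (p x y) (p g x)" using * assoc el closed by simp
  also have "\<dots> = p g x" using inv unit el closed by simp
  finally show "p x f = p g x" .
qed

lemma unital_assoc_ground: "unital_assoc (ground :: ('k::field, 'k) vspace) (*) 1"
  using is_vspace_ground
  by (auto simp: unital_assoc_def bilinear_map_def linear_map_def algebra_simps)

definition hom_space ::
  "('k::field, 'v::ab_group_add, 'y) vspace_scheme \<Rightarrow> ('k, 'w::ab_group_add, 'z) vspace_scheme
    \<Rightarrow> ('k, 'v \<Rightarrow> 'w) vspace" where
  "hom_space V W = \<lparr>vcarrier = {f. linear_map V W f}, vscale = (\<lambda>c f x. vscale W c (f x))\<rparr>"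

lemma hom_space_simps [simp]:
  "f \<in> vcarrier (hom_space V W) \<longleftrightarrow> linear_map V W f"
  "vscale (hom_space V W) c f = (\<lambda>x. vscale W c (f x))"
  by (simp_all add: hom_space_def)

lemma is_vspace_hom_space:
  assumes V: "is_vspace V" and W: "is_vspace W"
  shows "is_vspace (hom_space V W)"
proof -
  interpret vector_space "vscale (hom_space V W)"
    by unfold_locales (auto simp: vspace_scale[OF W])
  show ?thesis unfolding is_vspace_def
  proof
    show "vector_space (vscale (hom_space V W))" by (rule vector_space_axioms)
    show "subspace (vcarrier (hom_space V W))"
      by (rule subspaceI)
         (auto simp: linear_map_def vspace_closed[OF W] vspace_scale[OF W] algebra_simps)
  qed
qed

locale bialgebra_over =
  fixes A :: "('k::field, 'a::ring_1) bialg"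
  assumes bialgebra_A: "bialgebra A"
begin

abbreviation sweedler :: "'a \<Rightarrow> ('a \<Rightarrow> 'a \<Rightarrow> 'w::ab_group_add) \<Rightarrow> 'w" where
  "sweedler a f \<equiv> tlift A A f (comult A a)"

abbreviation \<epsilon> :: "'a \<Rightarrow> 'k" where "\<epsilon> \<equiv> counit A"

lemma is_vspace_A: "is_vspace A"
  and carrier_A [simp]: "vcarrier A = UNIV"
  and bilinear_mult: "bilinear_map A A A (*)"
  and linear_comult: "linear_map A (tensor_prod A A) (comult A)"
  and linear_counit: "linear_map A ground (counit A)"
  and counit_left: "sweedler a (\<lambda>x y. vscale A (\<epsilon> x) y) = a"
  and counit_right: "sweedler a (\<lambda>x y. vscale A (\<epsilon> y) x) = a"
  and comult_mult: "comult A (a * b) =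
        sweedler a (\<lambda>x y. sweedler b (\<lambda>u v. tens A A (x * u) (y * v)))"
  and comult_1: "comult A 1 = tens A A 1 1"
  and counit_mult: "\<epsilon> (a * b) = \<epsilon> a * \<epsilon> b"
  and counit_1: "\<epsilon> 1 = 1"
  using bialgebra_A by (auto simp: bialgebra_def unital_algebra_def coalgebra_def)

lemma linear_map_A_closed: "linear_map A W f \<Longrightarrow> f x \<in> vcarrier W"
  by (simp add: linear_map_def)

lemma linear_map_hom_space_iff: "linear_map U (hom_space A W) f \<longleftrightarrow> bilinear_map U A W f"
  by (auto simp: linear_map_def bilinear_map_def fun_eq_iff)

lemma comult_closed: "comult A a \<in> vcarrier (tensor_prod A A)"
  using linear_comult by (simp add: linear_map_def)

lemma tens_closed_A: "tens A A a b \<in> vcarrier (tensor_prod A A)"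
  by (rule tens_in_tensor_prod) simp_all

lemmas linear_map_sweedler =
  linear_map_tlift[OF is_vspace_A comult_closed]
lemmas linear_map_sweedler_integrand =
  linear_map_tlift_integrand[OF is_vspace_A comult_closed]
lemmas sweedler_closed = tlift_closed[OF is_vspace_A comult_closed]

lemma linear_sweedler:
  assumes "is_vspace W" "bilinear_map A A W g"
  shows "linear_map A W (\<lambda>a. sweedler a g)"
  using linear_map_comp[OF tensor_universal(1)[OF is_vspace_A assms] linear_comult] .

lemma sweedler_1:
  assumes "is_vspace W" "bilinear_map A A W g"
  shows "sweedler 1 g = g 1 1"
  unfolding comult_1 by (rule tensor_universal(2)[OF is_vspace_A assms]) simp_all

lemma sweedler_mult:
  assumes W: "is_vspace W" and g: "bilinear_map A A W g"
  shows "sweedler (a * b) g = sweedler a (\<lambda>x y. sweedler b (\<lambda>u v. g (x * u) (y * v)))"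
proof -
  note L = tensor_universal(1)[OF is_vspace_A W g]
  have "sweedler (a * b) g
      = sweedler a (\<lambda>x y. tlift A A g (sweedler b (\<lambda>u v. tens A A (x * u) (y * v))))"
    unfolding comult_mult
    by (rule linear_map_sweedler[OF is_vspace_tensor_prod L])
       (rule sweedler_closed[OF is_vspace_tensor_prod tens_closed_A])
  also have "\<dots> = sweedler a (\<lambda>x y. sweedler b (\<lambda>u v. g (x * u) (y * v)))"
    by (simp add: linear_map_sweedler[OF is_vspace_tensor_prod L tens_closed_A]
        tensor_universal(2)[OF is_vspace_A W g])
  finally show ?thesis .
qed

lemma sweedler_counit_left:
  assumes "is_vspace W" "linear_map A W g"
  shows "sweedler a (\<lambda>x y. vscale W (\<epsilon> x) (g y)) = g a"
proof -
  have "g a = g (sweedler a (\<lambda>x y. vscale A (\<epsilon> x) y))" by (simp add: counit_left)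
  also have "\<dots> = sweedler a (\<lambda>x y. vscale W (\<epsilon> x) (g y))"
    by (simp add: linear_map_sweedler[OF is_vspace_A assms(2)] linear_mapD(3)[OF assms(2)])
  finally show ?thesis ..
qed

lemma sweedler_counit_right:
  assumes "is_vspace W" "linear_map A W g"
  shows "sweedler a (\<lambda>x y. vscale W (\<epsilon> y) (g x)) = g a"
proof -
  have "g a = g (sweedler a (\<lambda>x y. vscale A (\<epsilon> y) x))" by (simp add: counit_right)
  also have "\<dots> = sweedler a (\<lambda>x y. vscale W (\<epsilon> y) (g x))"
    by (simp add: linear_map_sweedler[OF is_vspace_A assms(2)] linear_mapD(3)[OF assms(2)])
  finally show ?thesis ..
qed

text \<open>\<open>f(a\<^sub>1\<^sub>1, a\<^sub>1\<^sub>2, a\<^sub>2) = f(a\<^sub>1, a\<^sub>2\<^sub>1, a\<^sub>2\<^sub>2)\<close> for trilinear \<open>f\<close>.\<close>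

lemma sweedler_coassoc:
  assumes W: "is_vspace W"
    and 1: "\<And>v y. linear_map A W (\<lambda>u. f u v y)"
    and 2: "\<And>u y. linear_map A W (\<lambda>v. f u v y)"
    and 3: "\<And>u v. linear_map A W (\<lambda>y. f u v y)"
  shows "sweedler a (\<lambda>x y. sweedler x (\<lambda>u v. f u v y)) = sweedler a (\<lambda>x y. sweedler y (\<lambda>u v. f x u v))"
proof -
  have bil: "bilinear_map A A W (f u)" for u
    using 2 3 by (simp add: bilinear_map_def)
  let ?B = "\<lambda>u t. tlift A A (f u) t"
  have B: "bilinear_map A (tensor_prod A A) W ?B"
    unfolding bilinear_map_def
    by (auto intro!: tensor_universal(1)[OF is_vspace_A W bil]
        linear_map_tlift_integrand[OF is_vspace_A _ W] 1)
  have coassoc: "sweedler a (\<lambda>x y. sweedler x (\<lambda>u v. tens A (tensor_prod A A) u (tens A A v y)))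
      = sweedler a (\<lambda>x y. tens A (tensor_prod A A) x (comult A y))"
    using bialgebra_A by (auto simp: bialgebra_def coalgebra_def)
  have "sweedler a (\<lambda>x y. sweedler x (\<lambda>u v. ?B u (tens A A v y))) = sweedler a (\<lambda>x y. ?B x (comult A y))"
    by (rule tlift_coassoc[OF is_vspace_A linear_comult is_vspace_A linear_comult W B _ coassoc])
       simp
  then show ?thesis by (simp add: tensor_universal(2)[OF is_vspace_A W bil])
qed

definition convolution :: "('b \<Rightarrow> 'c \<Rightarrow> 'd::ab_group_add) \<Rightarrow> ('a \<Rightarrow> 'b) \<Rightarrow> ('a \<Rightarrow> 'c) \<Rightarrow> 'a \<Rightarrow> 'd" where
  "convolution p F G = (\<lambda>a. sweedler a (\<lambda>x y. p (F x) (G y)))"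

lemma linear_convolution:
  assumes "unital_assoc B p u" "linear_map A B F" "linear_map A B G"
  shows "linear_map A B (convolution p F G)"
  unfolding convolution_def
  by (rule linear_sweedler[OF unital_assocD(1)[OF assms(1)]
        bilinear_map_comp[OF unital_assocD(2)[OF assms(1)] assms(2,3)]])

text \<open>
  Since the target is an arbitrary algebra, this can be iterated: linear maps into the dual, that is
  bilinear forms, are again a convolution algebra, and so are linear maps into those.
\<close>

theorem unital_assoc_convolution:
  assumes B: "unital_assoc B p u"
  shows "unital_assoc (hom_space A B) (convolution p) (\<lambda>a. vscale B (\<epsilon> a) u)"
  unfolding unital_assoc_def
proof (intro conjI ballI; (simp only: hom_space_simps)?)
  note VB = unital_assocD(1)[OF B] and p = unital_assocD(2)[OF B] and u = unital_assocD(3)[OF B]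
  note pD = linear_mapD[OF bilinear_mapD(1)[OF p]] linear_mapD[OF bilinear_mapD(2)[OF p]]
  show "is_vspace (hom_space A B)" by (rule is_vspace_hom_space[OF is_vspace_A VB])
  show "linear_map A B (\<lambda>a. vscale B (\<epsilon> a) u)"
    by (rule linear_map_scale[OF VB linear_counit u])
  show "bilinear_map (hom_space A B) (hom_space A B) (hom_space A B) (convolution p)"
    unfolding bilinear_map_def linear_map_def[of "hom_space A B"]
    by (simp add: linear_convolution[OF B])
       (simp add: convolution_def fun_eq_iff tlift_add[symmetric] vscale_tlift[OF VB] pD
         linear_map_A_closed)
  fix F assume F: "linear_map A B F"
  have FB: "F x \<in> vcarrier B" for x using linear_mapD(1)[OF F] by simp
  show "convolution p (\<lambda>a. vscale B (\<epsilon> a) u) F = F"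
    using sweedler_counit_left[OF VB F] unital_assocD(4)[OF B]
    by (simp add: convolution_def pD u FB)
  show "convolution p F (\<lambda>a. vscale B (\<epsilon> a) u) = F"
    using sweedler_counit_right[OF VB F] unital_assocD(5)[OF B]
    by (simp add: convolution_def pD u FB)
  fix G H assume G: "linear_map A B G" and H: "linear_map A B H"
  have GB: "G x \<in> vcarrier B" for x using linear_mapD(1)[OF G] by simp
  have HB: "H x \<in> vcarrier B" for x using linear_mapD(1)[OF H] by simp
  have pB: "p x y \<in> vcarrier B" if "x \<in> vcarrier B" "y \<in> vcarrier B" for x y
    using unital_assocD(7)[OF B] that by blast
  show "convolution p (convolution p F G) H = convolution p F (convolution p G H)"
  proof
    fix a
    have "convolution p (convolution p F G) H a
        = sweedler a (\<lambda>x y. sweedler x (\<lambda>v w. p (F v) (p (G w) (H y))))"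
      by (simp add: convolution_def unital_assocD(6)[OF B] FB GB HB pB
          linear_map_sweedler[OF VB bilinear_mapD(2)[OF p]])
    also have "\<dots> = sweedler a (\<lambda>x y. sweedler y (\<lambda>v w. p (F x) (p (G v) (H w))))"
      by (rule sweedler_coassoc[OF VB])
         (auto intro!: linear_map_comp[OF bilinear_mapD(2)[OF p]]
           linear_map_comp[OF bilinear_mapD(1)[OF p]] F G H FB GB HB pB)
    also have "\<dots> = convolution p F (convolution p G H) a"
      by (simp add: convolution_def FB GB HB pB linear_map_sweedler[OF VB bilinear_mapD(1)[OF p]])
    finally show "convolution p (convolution p F G) H a = convolution p F (convolution p G H) a" .
  qed
qed

text \<open>\<open>\<rho>(1)\<close> is an idempotent with right inverse \<open>\<sigma>(1)\<close>, as \<open>1\<close> is grouplike.\<close>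

lemma inverse_multiplicative_at_1:
  assumes B: "unital_assoc B p u" and \<rho>: "linear_map A B \<rho>" and \<sigma>: "linear_map A B \<sigma>"
    and inv: "convolution p \<rho> \<sigma> = (\<lambda>a. vscale B (\<epsilon> a) u)" and idem: "p (\<rho> 1) (\<rho> 1) = \<rho> 1"
  shows "\<rho> 1 = u"
proof -
  note VB = unital_assocD(1)[OF B]
  have B1: "\<rho> 1 \<in> vcarrier B" "\<sigma> 1 \<in> vcarrier B"
    using linear_mapD(1)[OF \<rho>] linear_mapD(1)[OF \<sigma>] by simp_all
  have "convolution p \<rho> \<sigma> 1 = p (\<rho> 1) (\<sigma> 1)"
    unfolding convolution_def
    by (rule sweedler_1[OF VB bilinear_map_comp[OF unital_assocD(2)[OF B] \<rho> \<sigma>]])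
  then have 1: "p (\<rho> 1) (\<sigma> 1) = u" by (simp add: inv counit_1 vspace_scale[OF VB])
  have "\<rho> 1 = p (\<rho> 1) (p (\<rho> 1) (\<sigma> 1))" using unital_assocD(5)[OF B] B1 1 by simp
  also have "\<dots> = p (\<rho> 1) (\<sigma> 1)" using unital_assocD(6)[OF B B1(1) B1(1) B1(2)] idem by simp
  finally show ?thesis using 1 by simp
qed

text \<open>
  The next two lemmas live in the algebra of linear maps from \<open>A\<close> to the convolution algebra of linear
  maps \<open>A \<rightarrow> B\<close>; its elements are the bilinear maps \<open>A \<times> A \<rightarrow> B\<close>. The map \<open>\<sigma>(ab)\<close> is inverse to \<open>\<rho>(ab)\<close>
  because the comultiplication is multiplicative, and \<open>\<sigma>(b) \<sigma>(a)\<close> is inverse to \<open>\<rho>(a) \<rho>(b)\<close> because the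
  two middle factors of \<open>\<rho>(a\<^sub>1) \<rho>(b\<^sub>1) \<sigma>(b\<^sub>2) \<sigma>(a\<^sub>2)\<close> cancel first.
\<close>

lemma convolution_inverse_mult:
  assumes B: "unital_assoc B p u" and \<rho>: "linear_map A B \<rho>" and \<sigma>: "linear_map A B \<sigma>"
    and inv: "convolution p \<rho> \<sigma> = (\<lambda>a. vscale B (\<epsilon> a) u)"
  shows "convolution (convolution p) (\<lambda>a b. \<rho> (a * b)) (\<lambda>a b. \<sigma> (a * b))
    = (\<lambda>a b. vscale B (\<epsilon> a) (vscale B (\<epsilon> b) u))"
proof (intro ext)
  fix a b
  note VB = unital_assocD(1)[OF B]
  have "convolution (convolution p) (\<lambda>a b. \<rho> (a * b)) (\<lambda>a b. \<sigma> (a * b)) a b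
     = convolution p \<rho> \<sigma> (a * b)"
    by (simp add: convolution_def tlift_apply
        sweedler_mult[OF VB bilinear_map_comp[OF unital_assocD(2)[OF B] \<rho> \<sigma>]])
  also have "\<dots> = vscale B (\<epsilon> a) (vscale B (\<epsilon> b) u)"
    by (simp add: inv counit_mult vspace_scale[OF VB])
  finally show "convolution (convolution p) (\<lambda>a b. \<rho> (a * b)) (\<lambda>a b. \<sigma> (a * b)) a b
     = vscale B (\<epsilon> a) (vscale B (\<epsilon> b) u)" .
qed

lemma convolution_inverse_antimult:
  assumes B: "unital_assoc B p u" and \<rho>: "linear_map A B \<rho>" and \<sigma>: "linear_map A B \<sigma>"
    and inv: "convolution p \<rho> \<sigma> = (\<lambda>a. vscale B (\<epsilon> a) u)"
  shows "convolution (convolution p) (\<lambda>a b. p (\<rho> a) (\<rho> b)) (\<lambda>a b. p (\<sigma> b) (\<sigma> a))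
    = (\<lambda>a b. vscale B (\<epsilon> a) (vscale B (\<epsilon> b) u))"
proof (intro ext)
  fix a b
  note VB = unital_assocD(1)[OF B] and p = unital_assocD(2)[OF B] and u = unital_assocD(3)[OF B]
  note pD = linear_mapD[OF bilinear_mapD(1)[OF p]] linear_mapD[OF bilinear_mapD(2)[OF p]]
  have \<rho>B: "\<rho> x \<in> vcarrier B" for x using linear_mapD(1)[OF \<rho>] by simp
  have \<sigma>B: "\<sigma> x \<in> vcarrier B" for x using linear_mapD(1)[OF \<sigma>] by simp
  have pB: "p x y \<in> vcarrier B" if "x \<in> vcarrier B" "y \<in> vcarrier B" for x y
    using unital_assocD(7)[OF B] that by blast
  have inv': "sweedler c (\<lambda>x y. p (\<rho> x) (\<sigma> y)) = vscale B (\<epsilon> c) u" for c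
    using fun_cong[OF inv, of c] by (simp add: convolution_def)
  have inner: "sweedler b (\<lambda>v w. p (p (\<rho> x) (\<rho> v)) (p (\<sigma> w) (\<sigma> y))) = vscale B (\<epsilon> b) (p (\<rho> x) (\<sigma> y))"
    for x y
  proof -
    have "sweedler b (\<lambda>v w. p (p (\<rho> x) (\<rho> v)) (p (\<sigma> w) (\<sigma> y)))
       = sweedler b (\<lambda>v w. p (\<rho> x) (p (p (\<rho> v) (\<sigma> w)) (\<sigma> y)))"
      by (simp add: unital_assocD(6)[OF B] \<rho>B \<sigma>B pB)
    also have "\<dots> = p (\<rho> x) (p (sweedler b (\<lambda>v w. p (\<rho> v) (\<sigma> w))) (\<sigma> y))"
      by (simp add: \<rho>B \<sigma>B pB linear_map_sweedler[OF VB bilinear_mapD(1)[OF p]]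
          linear_map_sweedler[OF VB bilinear_mapD(2)[OF p]])
    also have "\<dots> = vscale B (\<epsilon> b) (p (\<rho> x) (\<sigma> y))"
      by (simp add: inv' pD u \<sigma>B \<rho>B unital_assocD(4)[OF B])
    finally show ?thesis .
  qed
  have "convolution (convolution p) (\<lambda>a b. p (\<rho> a) (\<rho> b)) (\<lambda>a b. p (\<sigma> b) (\<sigma> a)) a b
    = sweedler a (\<lambda>x y. vscale B (\<epsilon> b) (p (\<rho> x) (\<sigma> y)))"
    by (simp add: convolution_def tlift_apply inner)
  also have "\<dots> = vscale B (\<epsilon> a) (vscale B (\<epsilon> b) u)"
    by (simp add: vscale_tlift[OF VB, symmetric] inv' vspace_scale[OF VB] mult.commute)
  finally show "convolution (convolution p) (\<lambda>a b. p (\<rho> a) (\<rho> b)) (\<lambda>a b. p (\<sigma> b) (\<sigma> a)) a b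
    = vscale B (\<epsilon> a) (vscale B (\<epsilon> b) u)" .
qed

text \<open>
  If \<open>\<rho>\<close> is multiplicative, \<open>\<sigma>(ab)\<close> and \<open>\<sigma>(b) \<sigma>(a)\<close> are inverse to the same bilinear map, hence equal;
  the converse is symmetric.
\<close>

theorem multiplicative_iff_inverse_antimultiplicative:
  assumes B: "unital_assoc B p u" and \<rho>: "linear_map A B \<rho>" and \<sigma>: "linear_map A B \<sigma>"
    and inv: "convolution p \<rho> \<sigma> = (\<lambda>a. vscale B (\<epsilon> a) u)"
    and inv': "convolution p \<sigma> \<rho> = (\<lambda>a. vscale B (\<epsilon> a) u)"
  shows "(\<forall>a b. \<rho> (a * b) = p (\<rho> a) (\<rho> b)) \<longleftrightarrow> (\<forall>a b. \<sigma> (a * b) = p (\<sigma> b) (\<sigma> a))"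
proof -
  note p = unital_assocD(2)[OF B]
  let ?H = "hom_space A (hom_space A B)"
  note H = unital_assoc_convolution[OF unital_assoc_convolution[OF B]]
  have unit: "vscale (hom_space A B) (\<epsilon> a) (\<lambda>b. vscale B (\<epsilon> b) u) = (\<lambda>b. vscale B (\<epsilon> a) (vscale B (\<epsilon> b) u))"
    for a by simp
  have mult: "(\<lambda>a b. f (a * b)) \<in> vcarrier ?H" if "linear_map A B f" for f
    using that bilinear_mult
    by (auto simp: linear_map_hom_space_iff) (auto simp: linear_map_def bilinear_map_def)
  have prod: "(\<lambda>a b. p (f a) (f b)) \<in> vcarrier ?H" "(\<lambda>a b. p (f b) (f a)) \<in> vcarrier ?H"
    if "linear_map A B f" for f
    using that p by (auto simp: linear_map_hom_space_iff) (auto simp: linear_map_def bilinear_map_def)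
  \<comment> \<open>The roles of \<open>\<rho>\<close>, \<open>\<sigma>\<close> and of the two arguments are exchanged in the lemma above.\<close>
  have swapped: "convolution (convolution p) (\<lambda>a b. p (\<sigma> b) (\<sigma> a)) (\<lambda>a b. p (\<rho> a) (\<rho> b))
    = (\<lambda>a b. vscale B (\<epsilon> a) (vscale B (\<epsilon> b) u))"
  proof (intro ext)
    fix a b
    have "convolution (convolution p) (\<lambda>a b. p (\<sigma> b) (\<sigma> a)) (\<lambda>a b. p (\<rho> a) (\<rho> b)) a b
       = convolution (convolution p) (\<lambda>a b. p (\<sigma> a) (\<sigma> b)) (\<lambda>a b. p (\<rho> b) (\<rho> a)) b a"
      by (simp add: convolution_def tlift_apply) (rule tlift_swap)
    also have "\<dots> = vscale B (\<epsilon> a) (vscale B (\<epsilon> b) u)"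
      by (simp add: convolution_inverse_antimult[OF B \<sigma> \<rho> inv'] vspace_scale[OF unital_assocD(1)[OF B]]
          mult.commute)
    finally show "convolution (convolution p) (\<lambda>a b. p (\<sigma> b) (\<sigma> a)) (\<lambda>a b. p (\<rho> a) (\<rho> b)) a b
       = vscale B (\<epsilon> a) (vscale B (\<epsilon> b) u)" .
  qed
  show ?thesis
  proof
    assume *: "\<forall>a b. \<rho> (a * b) = p (\<rho> a) (\<rho> b)"
    have "(\<lambda>a b. \<sigma> (a * b)) = (\<lambda>a b. p (\<sigma> b) (\<sigma> a))"
      by (rule left_inverse_eq_right_inverse[OF H mult[OF \<sigma>] prod(2)[OF \<sigma>] mult[OF \<rho>]])
         (use convolution_inverse_mult[OF B \<sigma> \<rho> inv'] convolution_inverse_antimult[OF B \<rho> \<sigma> inv] *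
          in simp_all)
    then show "\<forall>a b. \<sigma> (a * b) = p (\<sigma> b) (\<sigma> a)" by meson
  next
    assume *: "\<forall>a b. \<sigma> (a * b) = p (\<sigma> b) (\<sigma> a)"
    have "(\<lambda>a b. \<rho> (a * b)) = (\<lambda>a b. p (\<rho> a) (\<rho> b))"
      by (rule left_inverse_eq_right_inverse[OF H mult[OF \<rho>] prod(1)[OF \<rho>] mult[OF \<sigma>]])
         (use convolution_inverse_mult[OF B \<rho> \<sigma> inv] swapped * in simp_all)
    then show "\<forall>a b. \<rho> (a * b) = p (\<rho> a) (\<rho> b)" by meson
  qed
qed

section \<open>Universal r-forms as pairs of braiding forms\<close>

lemma functionals_separate:
  "v = w \<longleftrightarrow> (\<forall>\<psi>. linear_map A ground \<psi> \<longrightarrow> \<psi> v = \<psi> w)"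
proof (intro iffI allI impI)
  assume *: "\<forall>\<psi>. linear_map A ground \<psi> \<longrightarrow> \<psi> v = \<psi> w"
  show "v = w"
  proof (rule ccontr)
    assume "v \<noteq> w"
    then have "v - w \<noteq> 0" by simp
    moreover have "vector_space (vscale A)" using is_vspace_A by (simp add: is_vspace_def)
    ultimately obtain \<psi> where \<psi>: "Vector_Spaces.linear (vscale A) (*) \<psi>" "\<psi> (v - w) \<noteq> 0"
      using separating_functional by blast
    interpret \<psi>: Vector_Spaces.linear "vscale A" "(*)" \<psi> by fact
    have "linear_map A ground \<psi>" by (simp add: linear_map_def \<psi>.add \<psi>.scale)
    then show False using * \<psi>(2) by (simp add: \<psi>.diff)
  qed
qed simp

abbreviation "dual \<equiv> hom_space A (ground :: ('k, 'k) vspace)"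
abbreviation dual_mult :: "('a \<Rightarrow> 'k) \<Rightarrow> ('a \<Rightarrow> 'k) \<Rightarrow> 'a \<Rightarrow> 'k" (infixl "\<star>" 70) where
  "f \<star> g \<equiv> convolution (*) f g"

lemma unital_assoc_dual: "unital_assoc dual (\<star>) \<epsilon>"
  using unital_assoc_convolution[OF unital_assoc_ground] by simp

lemma unital_assoc_forms: "unital_assoc (hom_space A dual) (convolution (\<star>)) (\<lambda>a b. \<epsilon> a * \<epsilon> b)"
  using unital_assoc_convolution[OF unital_assoc_dual] by simp

text \<open>
  \<open>\<kappa>(a\<^sub>1, c\<^sub>1) c\<^sub>2 a\<^sub>2 = \<kappa>(a\<^sub>2, c\<^sub>2) a\<^sub>1 c\<^sub>1\<close>. For \<open>\<kappa>(a, c) = r(c \<otimes> a)\<close> this is (CQT.3); for an action of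
  the form \<open>\<kappa>(a, m\<^sub>1) m\<^sub>0\<close> it is what the compatibility of action and coaction amounts to.
\<close>

definition commutes :: "('a \<Rightarrow> 'a \<Rightarrow> 'k) \<Rightarrow> bool" where
  "commutes \<kappa> \<longleftrightarrow> (\<forall>a c.
     sweedler c (\<lambda>x y. sweedler a (\<lambda>u v. vscale A (\<kappa> u x) (y * v)))
     = sweedler c (\<lambda>x y. sweedler a (\<lambda>u v. vscale A (\<kappa> v y) (u * x))))"

text \<open>
  The conditions on \<open>\<kappa>\<close> that make every comodule a Yetter--Drinfeld module under
  \<open>m \<triangleleft> a = \<kappa>(a, m\<^sub>1) m\<^sub>0\<close>. The form is curried so that \<open>\<kappa>\<close> is a map from \<open>A\<close> to its dual algebra; it is
  antimultiplicative because in \<open>(m \<triangleleft> a) \<triangleleft> b = \<kappa>(b, m\<^sub>1) \<kappa>(a, m\<^sub>2) m\<^sub>0\<close> the element acting first takes the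
  last factor of the coaction.
\<close>

definition braiding :: "('a \<Rightarrow> 'a \<Rightarrow> 'k) \<Rightarrow> bool" where
  "braiding \<kappa> \<longleftrightarrow> \<kappa> 1 = \<epsilon> \<and> (\<forall>a b. \<kappa> (a * b) = \<kappa> b \<star> \<kappa> a) \<and> commutes \<kappa>"

lemma commutation_bilinear:
  assumes \<kappa>: "bilinear_map A A ground \<kappa>"
  shows "bilinear_map A A A (\<lambda>x y. sweedler a (\<lambda>u v. vscale A (\<kappa> u x) (y * v)))"
    and "bilinear_map A A A (\<lambda>x y. sweedler a (\<lambda>u v. vscale A (\<kappa> v y) (u * x)))"
  unfolding bilinear_map_def
  by (intro conjI ballI linear_map_sweedler_integrand is_vspace_A;
      use bilinear_map_scale[OF is_vspace_A] bilinear_mult \<kappa> in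
        \<open>auto simp: bilinear_map_def linear_map_def\<close>)+

text \<open>
  Let \<open>\<psi>\<close> be a functional on \<open>A\<close>, and \<open>P(a, b) = \<psi>(ab)\<close>, \<open>Q(a, b) = \<psi>(ba)\<close>. In the algebra of bilinear
  forms the first condition, tested with \<open>\<psi>\<close>, is \<open>\<rho> P = Q \<rho>\<close> and the second is \<open>P \<sigma> = \<sigma> Q\<close>.
\<close>

lemma commutes_inverse:
  assumes \<rho>: "bilinear_map A A ground \<rho>" and \<sigma>: "bilinear_map A A ground \<sigma>"
    and inv: "convolution (\<star>) \<rho> \<sigma> = (\<lambda>a b. \<epsilon> a * \<epsilon> b)" "convolution (\<star>) \<sigma> \<rho> = (\<lambda>a b. \<epsilon> a * \<epsilon> b)"
  shows "commutes (\<lambda>a c. \<rho> c a) \<longleftrightarrow> commutes \<sigma>"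
proof -
  let ?P = "\<lambda>\<psi> a b. \<psi> (a * b)" and ?Q = "\<lambda>\<psi> a b. \<psi> (b * a)"
  have 1: "commutes (\<lambda>a c. \<rho> c a) \<longleftrightarrow>
     (\<forall>\<psi>. linear_map A ground \<psi> \<longrightarrow> convolution (\<star>) \<rho> (?P \<psi>) = convolution (\<star>) (?Q \<psi>) \<rho>)"
    unfolding commutes_def functionals_separate
    by (auto simp: fun_eq_iff convolution_def tlift_apply linear_map_sweedler[OF is_vspace_A]
        linear_mapD(3) mult.commute cong: imp_cong)
  have 2: "commutes \<sigma> \<longleftrightarrow>
     (\<forall>\<psi>. linear_map A ground \<psi> \<longrightarrow> convolution (\<star>) (?P \<psi>) \<sigma> = convolution (\<star>) \<sigma> (?Q \<psi>))"
    unfolding commutes_def functionals_separate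
    by (subst (1 2) tlift_swap) (auto simp: fun_eq_iff convolution_def tlift_apply linear_map_sweedler[OF is_vspace_A]
        linear_mapD(3) mult.commute cong: imp_cong)
  show ?thesis unfolding 1 2
  proof (rule all_cong1, rule imp_cong[OF refl])
    fix \<psi> assume \<psi>: "linear_map A ground \<psi>"
    have "bilinear_map A A ground (?P \<psi>)" "bilinear_map A A ground (?Q \<psi>)"
      using \<psi> bilinear_mult by (auto simp: linear_map_def bilinear_map_def)
    then show "convolution (\<star>) \<rho> (?P \<psi>) = convolution (\<star>) (?Q \<psi>) \<rho>
      \<longleftrightarrow> convolution (\<star>) (?P \<psi>) \<sigma> = convolution (\<star>) \<sigma> (?Q \<psi>)"
      by (intro intertwiner_inverse[OF unital_assoc_forms _ _ _ _ inv])
         (simp_all add: \<rho> \<sigma> linear_map_hom_space_iff)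
  qed
qed

lemma antimultiplicative_at_1:
  assumes \<rho>: "bilinear_map A A ground \<rho>" and \<sigma>: "bilinear_map A A ground \<sigma>"
    and inv: "convolution (\<star>) \<rho> \<sigma> = (\<lambda>a b. \<epsilon> a * \<epsilon> b)"
    and anti: "\<forall>a b. \<rho> (a * b) = \<rho> b \<star> \<rho> a"
  shows "\<rho> 1 = \<epsilon>"
  by (rule inverse_multiplicative_at_1[OF unital_assoc_dual])
     (use \<rho> \<sigma> inv spec[OF spec[OF anti, of 1], of 1] in \<open>simp_all add: linear_map_hom_space_iff\<close>)

lemma bilinear_form_of_functional:
  assumes "linear_functional2 A r"
  shows "bilinear_map A A ground (\<lambda>a b. r (tens A A a b))"
  using bilinear_tens[of A A] linear_map_comp[OF assms[unfolded linear_functional2_def]]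
  by (auto simp: bilinear_map_def)

lemma convolution2_eq:
  "convolution2 A r s a b = convolution (\<star>) (\<lambda>a b. r (tens A A a b)) (\<lambda>a b. s (tens A A a b)) a b"
  by (simp add: convolution2_def convolution_def tlift_apply)

theorem universal_r_form_iff_braiding:
  assumes r: "linear_functional2 A r" and s: "is_convolution_inverse A r s"
  shows "universal_r_form A r \<longleftrightarrow>
    braiding (\<lambda>a c. r (tens A A c a)) \<and> braiding (\<lambda>a c. s (tens A A a c))"
proof -
  let ?\<rho> = "\<lambda>a b. r (tens A A a b)" and ?\<sigma> = "\<lambda>a b. s (tens A A a b)"
  let ?\<rho>' = "\<lambda>a b. ?\<rho> b a" and ?\<sigma>' = "\<lambda>a b. ?\<sigma> b a"
  have \<rho>: "bilinear_map A A ground ?\<rho>" and \<sigma>: "bilinear_map A A ground ?\<sigma>"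
    using r s by (auto simp: is_convolution_inverse_def intro: bilinear_form_of_functional)
  then have \<rho>': "bilinear_map A A ground ?\<rho>'" and \<sigma>': "bilinear_map A A ground ?\<sigma>'"
    by (auto simp: bilinear_map_def)
  have inv: "convolution (\<star>) ?\<rho> ?\<sigma> = (\<lambda>a b. \<epsilon> a * \<epsilon> b)" "convolution (\<star>) ?\<sigma> ?\<rho> = (\<lambda>a b. \<epsilon> a * \<epsilon> b)"
    using s by (auto simp: is_convolution_inverse_def fun_eq_iff convolution2_eq)
  have inv': "convolution (\<star>) ?\<rho>' ?\<sigma>' = (\<lambda>a b. \<epsilon> a * \<epsilon> b)"
  proof (intro ext)
    fix a b
    have "convolution (\<star>) ?\<rho>' ?\<sigma>' a b = convolution (\<star>) ?\<rho> ?\<sigma> b a"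
      by (simp add: convolution_def tlift_apply) (rule tlift_swap)
    then show "convolution (\<star>) ?\<rho>' ?\<sigma>' a b = \<epsilon> a * \<epsilon> b" by (simp add: inv(1) mult.commute)
  qed
  have cqt2: "(\<forall>a b. ?\<rho> (a * b) = ?\<rho> a \<star> ?\<rho> b) \<longleftrightarrow> (\<forall>a b. ?\<sigma> (a * b) = ?\<sigma> b \<star> ?\<sigma> a)"
    by (rule multiplicative_iff_inverse_antimultiplicative[OF unital_assoc_dual])
       (simp_all add: \<rho> \<sigma> inv linear_map_hom_space_iff)
  have "universal_r_form A r \<longleftrightarrow>
    (\<forall>a b. ?\<rho>' (a * b) = ?\<rho>' b \<star> ?\<rho>' a) \<and> (\<forall>a b. ?\<rho> (a * b) = ?\<rho> a \<star> ?\<rho> b) \<and> commutes ?\<rho>'"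
    using r s unfolding universal_r_form_def convolution_invertible_def commutes_def
    by (auto simp: fun_eq_iff convolution_def)
  also have "\<dots> \<longleftrightarrow> braiding ?\<rho>' \<and> braiding ?\<sigma>"
    unfolding cqt2 braiding_def commutes_inverse[OF \<rho> \<sigma> inv]
    using antimultiplicative_at_1[OF \<rho>' \<sigma>' inv'] antimultiplicative_at_1[OF \<sigma> \<rho> inv(2)] by auto
  finally show ?thesis .
qed

end

section \<open>Comodules with an action given by a bilinear form\<close>

locale comodule_over = bialgebra_over A
  for A :: "('k::field, 'a::ring_1) bialg" +
  fixes M :: "('k, 'm::ab_group_add, 'a) comod"
  assumes comodule_M: "right_comodule A M"
begin

abbreviation cosweedler :: "'m \<Rightarrow> ('m \<Rightarrow> 'a \<Rightarrow> 'w::ab_group_add) \<Rightarrow> 'w" where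
  "cosweedler m f \<equiv> tlift M A f (coact M m)"

lemma is_vspace_M: "is_vspace M"
  and linear_coact: "linear_map M (tensor_prod M A) (coact M)"
  and coact_counit: "m \<in> vcarrier M \<Longrightarrow> cosweedler m (\<lambda>n y. vscale M (\<epsilon> y) n) = m"
  using comodule_M by (auto simp: right_comodule_def)

lemmas coact_closed = linear_mapD(1)[OF linear_coact]
lemmas linear_map_cosweedler = linear_map_tlift[OF is_vspace_M coact_closed]
lemmas linear_map_cosweedler_integrand = linear_map_tlift_integrand[OF is_vspace_M coact_closed]
lemmas cosweedler_cong = tlift_cong[OF is_vspace_M coact_closed]

lemma linear_cosweedler:
  assumes "is_vspace X" "bilinear_map M A X g"
  shows "linear_map M X (\<lambda>m. cosweedler m g)"
  using linear_map_comp[OF tensor_universal(1)[OF is_vspace_M assms] linear_coact] .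

text \<open>
  \<open>\<beta>(m\<^sub>0\<^sub>0, g(m\<^sub>0\<^sub>1, m\<^sub>1)) = \<beta>(m\<^sub>0, g(m\<^sub>1\<^sub>1, m\<^sub>1\<^sub>2))\<close>. This collects all coefficients in \<open>A\<close> into one linear
  map applied to \<open>m\<^sub>1\<close>, and brings each Yetter--Drinfeld axiom into the form \<open>\<beta>(m\<^sub>0, F(m\<^sub>1))\<close>.
\<close>

lemma cosweedler_coassoc:
  assumes W: "is_vspace W" and X: "is_vspace X"
    and \<beta>: "bilinear_map M W X \<beta>" and g: "bilinear_map A A W g" and m: "m \<in> vcarrier M"
  shows "cosweedler m (\<lambda>n y. cosweedler n (\<lambda>p z. \<beta> p (g z y)))
    = cosweedler m (\<lambda>n y. \<beta> n (sweedler y g))"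
proof -
  let ?B = "\<lambda>p t. \<beta> p (tlift A A g t)"
  note lift = tensor_universal(1,2)[OF is_vspace_A W g]
  have B: "bilinear_map M (tensor_prod A A) X ?B"
    unfolding bilinear_map_def
    by (auto intro!: linear_map_comp[OF bilinear_mapD(1)[OF \<beta>] lift(1)]
        bilinear_mapD(2)[OF \<beta>] linear_mapD(1)[OF lift(1)])
  have coassoc: "cosweedler m (\<lambda>n b. cosweedler n (\<lambda>p c. tens M (tensor_prod A A) p (tens A A c b)))
      = cosweedler m (\<lambda>n b. tens M (tensor_prod A A) n (comult A b))"
    using comodule_M m by (simp add: right_comodule_def)
  have "cosweedler m (\<lambda>n y. cosweedler n (\<lambda>p z. ?B p (tens A A z y)))
      = cosweedler m (\<lambda>n y. ?B n (comult A y))"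
    by (rule tlift_coassoc[OF is_vspace_M linear_coact is_vspace_A linear_comult X B m coassoc])
  then show ?thesis by (simp add: lift(2))
qed

lemma bilinear_smult: "bilinear_map M ground M (\<lambda>n c. vscale M c n)"
  using bilinear_map_scale[OF is_vspace_M] by (auto simp: bilinear_map_def)

definition form_action :: "('a \<Rightarrow> 'a \<Rightarrow> 'k) \<Rightarrow> 'm \<Rightarrow> 'a \<Rightarrow> 'm" where
  "form_action \<kappa> m a = cosweedler m (\<lambda>n y. vscale M (\<kappa> a y) n)"

context
  fixes \<kappa> :: "'a \<Rightarrow> 'a \<Rightarrow> 'k"
  assumes \<kappa>: "bilinear_map A A ground \<kappa>"
begin

lemma linear_\<kappa>: "linear_map A ground (\<kappa> a)" "linear_map A ground (\<lambda>a. \<kappa> a c)"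
  using \<kappa> by (auto simp: bilinear_map_def)

lemma bilinear_integrand: "bilinear_map M A M (\<lambda>n y. vscale M (\<kappa> a y) n)"
  using bilinear_smult linear_\<kappa>(1)[of a] by (auto simp: bilinear_map_def linear_map_def)

lemma bilinear_form_action: "bilinear_map M A M (form_action \<kappa>)"
  unfolding bilinear_map_def form_action_def
  by (auto intro!: linear_cosweedler is_vspace_M bilinear_integrand
      linear_map_cosweedler_integrand linear_map_scale linear_\<kappa>)

lemma linear_map_form_action:
  assumes L: "linear_map M X L" and m: "m \<in> vcarrier M"
  shows "L (form_action \<kappa> m a) = cosweedler m (\<lambda>n y. vscale X (\<kappa> a y) (L n))"
  unfolding form_action_def
  by (simp add: linear_map_cosweedler[OF m is_vspace_M L] vspace_closed[OF is_vspace_M])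
     (rule cosweedler_cong[OF m], rule linear_mapD(3)[OF L])

lemma form_action_action:
  assumes m: "m \<in> vcarrier M"
  shows "form_action \<kappa> (form_action \<kappa> m a) b
    = cosweedler m (\<lambda>n y. vscale M ((\<kappa> b \<star> \<kappa> a) y) n)"
proof -
  have L: "linear_map M M (\<lambda>m. form_action \<kappa> m b)"
    using bilinear_form_action by (simp add: bilinear_map_def)
  have g: "bilinear_map A A ground (\<lambda>z y. \<kappa> b z * \<kappa> a y)"
    using linear_\<kappa>(1) by (auto simp: bilinear_map_def linear_map_def algebra_simps)
  have "form_action \<kappa> (form_action \<kappa> m a) b
    = cosweedler m (\<lambda>n y. cosweedler n (\<lambda>p z. vscale M (\<kappa> b z * \<kappa> a y) p))"
    unfolding linear_map_form_action[OF L m]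
    by (simp add: form_action_def vscale_tlift[OF is_vspace_M] vspace_scale[OF is_vspace_M] mult.commute)
  also have "\<dots> = cosweedler m (\<lambda>n y. vscale M (sweedler y (\<lambda>z y. \<kappa> b z * \<kappa> a y)) n)"
    by (rule cosweedler_coassoc[OF is_vspace_ground is_vspace_M bilinear_smult g m])
  finally show ?thesis by (simp add: convolution_def)
qed

lemma tens_scale:
  "n \<in> vcarrier M \<Longrightarrow> tens M A (vscale M c n) y = tens M A n (vscale A c y)"
  "n \<in> vcarrier M \<Longrightarrow> vscale (tensor_prod M A) c (tens M A n y) = tens M A n (vscale A c y)"
  using bilinear_tens[of M A] by (auto simp: bilinear_map_def linear_map_def)

lemma yd_left:
  assumes m: "m \<in> vcarrier M"
  shows "cosweedler m (\<lambda>m0 m1. sweedler a (\<lambda>a1 a2. tens M A (form_action \<kappa> m0 a1) (m1 * a2)))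
    = cosweedler m (\<lambda>n c. tens M A n (sweedler c (\<lambda>x y. sweedler a (\<lambda>u v. vscale A (\<kappa> u x) (y * v)))))"
proof -
  have inner: "sweedler a (\<lambda>a1 a2. tens M A (form_action \<kappa> m0 a1) (m1 * a2))
     = cosweedler m0 (\<lambda>p z. tens M A p (sweedler a (\<lambda>u v. vscale A (\<kappa> u z) (m1 * v))))"
    if m0: "m0 \<in> vcarrier M" for m0 m1
  proof -
    have L: "linear_map M (tensor_prod M A) (\<lambda>n. tens M A n y)" for y
      using bilinear_tens[of M A] by (simp add: bilinear_map_def)
    have "sweedler a (\<lambda>a1 a2. tens M A (form_action \<kappa> m0 a1) (m1 * a2))
      = sweedler a (\<lambda>a1 a2. cosweedler m0 (\<lambda>p z. tens M A p (vscale A (\<kappa> a1 z) (m1 * a2))))"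
      unfolding linear_map_form_action[OF L m0]
      by (intro tlift_cong[OF is_vspace_A comult_closed] cosweedler_cong[OF m0] tens_scale)
    also have "\<dots> = cosweedler m0 (\<lambda>p z. sweedler a (\<lambda>a1 a2. tens M A p (vscale A (\<kappa> a1 z) (m1 * a2))))"
      by (rule tlift_swap)
    also have "\<dots> = cosweedler m0 (\<lambda>p z. tens M A p (sweedler a (\<lambda>u v. vscale A (\<kappa> u z) (m1 * v))))"
      by (intro cosweedler_cong[OF m0] linear_map_sweedler[OF is_vspace_A bilinear_mapD(1)[OF bilinear_tens], symmetric]) simp_all
    finally show ?thesis .
  qed
  have "cosweedler m (\<lambda>m0 m1. sweedler a (\<lambda>a1 a2. tens M A (form_action \<kappa> m0 a1) (m1 * a2)))
    = cosweedler m (\<lambda>n y. cosweedler n (\<lambda>p z. tens M A p (sweedler a (\<lambda>u v. vscale A (\<kappa> u z) (y * v)))))"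
    by (intro cosweedler_cong[OF m] inner)
  also have "\<dots> = cosweedler m (\<lambda>n c. tens M A n (sweedler c (\<lambda>x y. sweedler a (\<lambda>u v. vscale A (\<kappa> u x) (y * v)))))"
    by (rule cosweedler_coassoc[OF is_vspace_A is_vspace_tensor_prod bilinear_tens commutation_bilinear(1)[OF \<kappa>] m])
  finally show ?thesis .
qed

lemma yd_right:
  assumes m: "m \<in> vcarrier M"
  shows "sweedler a (\<lambda>a1 a2. cosweedler (form_action \<kappa> m a2) (\<lambda>n0 n1. tens M A n0 (a1 * n1)))
    = cosweedler m (\<lambda>n c. tens M A n (sweedler c (\<lambda>x y. sweedler a (\<lambda>u v. vscale A (\<kappa> v y) (u * x)))))"
proof -
  have L: "linear_map M (tensor_prod M A) (\<lambda>m. cosweedler m (\<lambda>n0 n1. tens M A n0 (a1 * n1)))" for a1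
    by (rule linear_cosweedler[OF is_vspace_tensor_prod])
       (use bilinear_tens[of M A] bilinear_mult in \<open>auto simp: bilinear_map_def linear_map_def\<close>)
  have inner: "vscale (tensor_prod M A) c (cosweedler n (\<lambda>p z. tens M A p (a1 * z)))
      = cosweedler n (\<lambda>p z. tens M A p (vscale A c (a1 * z)))" if n: "n \<in> vcarrier M" for c n a1
    unfolding vscale_tlift[OF is_vspace_tensor_prod]
    by (intro cosweedler_cong[OF n] tens_scale)
  have "sweedler a (\<lambda>a1 a2. cosweedler (form_action \<kappa> m a2) (\<lambda>n0 n1. tens M A n0 (a1 * n1)))
    = sweedler a (\<lambda>a1 a2. cosweedler m (\<lambda>n y. cosweedler n (\<lambda>p z. tens M A p (vscale A (\<kappa> a2 y) (a1 * z)))))"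
    unfolding linear_map_form_action[OF L m]
    by (intro tlift_cong[OF is_vspace_A comult_closed] cosweedler_cong[OF m] inner)
  also have "\<dots> = cosweedler m (\<lambda>n y. cosweedler n (\<lambda>p z. sweedler a (\<lambda>u v. tens M A p (vscale A (\<kappa> v y) (u * z)))))"
    by (subst tlift_swap, subst tlift_swap) (rule refl)
  also have "\<dots> = cosweedler m (\<lambda>n y. cosweedler n (\<lambda>p z. tens M A p (sweedler a (\<lambda>u v. vscale A (\<kappa> v y) (u * z)))))"
    by (intro cosweedler_cong[OF m] cosweedler_cong linear_map_sweedler[OF is_vspace_A bilinear_mapD(1)[OF bilinear_tens], symmetric]) simp_all
  also have "\<dots> = cosweedler m (\<lambda>n c. tens M A n (sweedler c (\<lambda>x y. sweedler a (\<lambda>u v. vscale A (\<kappa> v y) (u * x)))))"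
    by (rule cosweedler_coassoc[OF is_vspace_A is_vspace_tensor_prod bilinear_tens commutation_bilinear(2)[OF \<kappa>] m])
  finally show ?thesis .
qed

text \<open>
  In each conjunct the two sides differ only in the linear map applied to \<open>m\<^sub>1\<close>, and equality of the
  three pairs of maps is \<open>braiding \<kappa>\<close>.
\<close>

theorem yetter_drinfeld_form_action_iff:
  "yetter_drinfeld A M (form_action \<kappa>) \<longleftrightarrow>
    (\<forall>m\<in>vcarrier M.
      cosweedler m (\<lambda>n y. vscale M (\<kappa> 1 y) n) = cosweedler m (\<lambda>n y. vscale M (\<epsilon> y) n) \<and>
      (\<forall>a b. cosweedler m (\<lambda>n y. vscale M (\<kappa> (a * b) y) n)
         = cosweedler m (\<lambda>n y. vscale M ((\<kappa> b \<star> \<kappa> a) y) n)) \<and>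
      (\<forall>a. cosweedler m (\<lambda>n c. tens M A n (sweedler c (\<lambda>x y. sweedler a (\<lambda>u v. vscale A (\<kappa> u x) (y * v)))))
         = cosweedler m (\<lambda>n c. tens M A n (sweedler c (\<lambda>x y. sweedler a (\<lambda>u v. vscale A (\<kappa> v y) (u * x)))))))"
  unfolding yetter_drinfeld_def right_module_def
  using comodule_M is_vspace_M bilinear_form_action
  by (auto simp: yd_left yd_right form_action_action coact_counit form_action_def[of \<kappa> _ 1]
      form_action_def[of \<kappa> _ "_ * _"])

end

section \<open>Detecting identities on matrix coefficients\<close>

text \<open>
  \<open>G(\<phi>(m\<^sub>0) m\<^sub>1) = \<Phi>(\<beta>(m\<^sub>0, G(m\<^sub>1)))\<close> recovers the values of \<open>G\<close> at matrix coefficients. Here \<open>\<beta>\<close> is either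
  the scalar multiplication of \<open>M\<close>, with \<open>\<Phi> = \<phi>\<close>, or the tensor product, with \<open>\<Phi> = \<phi> \<otimes> id\<close>.
\<close>

lemma matrix_coefficient_eq:
  assumes X: "is_vspace X" and \<beta>: "\<And>n w. n \<in> vcarrier M \<Longrightarrow> w \<in> vcarrier W \<Longrightarrow> \<beta> n w \<in> vcarrier X"
    and \<Phi>: "linear_map X W \<Phi>" "\<And>n w. \<lbrakk>n \<in> vcarrier M; w \<in> vcarrier W\<rbrakk> \<Longrightarrow> \<Phi> (\<beta> n w) = vscale W (\<phi> n) w"
    and G: "linear_map A W G" and m: "m \<in> vcarrier M"
  shows "G (cosweedler m (\<lambda>n y. vscale A (\<phi> n) y)) = \<Phi> (cosweedler m (\<lambda>n y. \<beta> n (G y)))"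
proof -
  have "G (cosweedler m (\<lambda>n y. vscale A (\<phi> n) y)) = cosweedler m (\<lambda>n y. vscale W (\<phi> n) (G y))"
    by (simp add: linear_map_cosweedler[OF m is_vspace_A G] linear_mapD(3)[OF G])
  also have "\<dots> = cosweedler m (\<lambda>n y. \<Phi> (\<beta> n (G y)))"
    by (intro cosweedler_cong[OF m] \<Phi>(2)[symmetric] linear_map_A_closed[OF G])
  also have "\<dots> = \<Phi> (cosweedler m (\<lambda>n y. \<beta> n (G y)))"
    by (intro linear_map_cosweedler[OF m X \<Phi>(1), symmetric] \<beta> linear_map_A_closed[OF G])
  finally show ?thesis .
qed

lemma eq_on_coefficients_tens:
  assumes W: "is_vspace W" and G: "linear_map A W G" and H: "linear_map A W H"
    and eq: "\<And>m. m \<in> vcarrier M \<Longrightarrow>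
      cosweedler m (\<lambda>n y. tens M W n (G y)) = cosweedler m (\<lambda>n y. tens M W n (H y))"
    and m: "m \<in> vcarrier M" and \<phi>: "linear_map M ground \<phi>"
  shows "G (cosweedler m (\<lambda>n y. vscale A (\<phi> n) y)) = H (cosweedler m (\<lambda>n y. vscale A (\<phi> n) y))"
proof -
  let ?\<Phi> = "tlift M W (\<lambda>n w. vscale W (\<phi> n) w)"
  have bil: "bilinear_map M W W (\<lambda>n w. vscale W (\<phi> n) w)"
    using bilinear_map_scale[OF W] \<phi> by (auto simp: bilinear_map_def linear_map_def)
  note \<Phi> = tensor_universal(1,2)[OF is_vspace_M W bil]
  have "F (cosweedler m (\<lambda>n y. vscale A (\<phi> n) y)) = ?\<Phi> (cosweedler m (\<lambda>n y. tens M W n (F y)))"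
    if "linear_map A W F" for F
    by (rule matrix_coefficient_eq[where X = "tensor_prod M W" and W = W and \<beta> = "tens M W"])
       (auto intro: is_vspace_tensor_prod tens_in_tensor_prod \<Phi> that m)
  from this[OF G] this[OF H] show ?thesis using eq[OF m] by simp
qed

lemma eq_on_coefficients_scale:
  assumes G: "linear_map A ground G" and H: "linear_map A ground H"
    and eq: "\<And>m. m \<in> vcarrier M \<Longrightarrow>
      cosweedler m (\<lambda>n y. vscale M (G y) n) = cosweedler m (\<lambda>n y. vscale M (H y) n)"
    and m: "m \<in> vcarrier M" and \<phi>: "linear_map M ground \<phi>"
  shows "G (cosweedler m (\<lambda>n y. vscale A (\<phi> n) y)) = H (cosweedler m (\<lambda>n y. vscale A (\<phi> n) y))"
proof -
  have *: "F (cosweedler m (\<lambda>n y. vscale A (\<phi> n) y)) = \<phi> (cosweedler m (\<lambda>n y. vscale M (F y) n))"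
    if "linear_map A ground F" for F
    by (rule matrix_coefficient_eq[where X = M and W = ground and \<beta> = "\<lambda>n c. vscale M c n"])
      (use that \<phi> m in \<open>auto simp: is_vspace_M vspace_closed linear_mapD(3) mult.commute\<close>)
  show ?thesis using *[OF G] *[OF H] eq[OF m] by simp
qed

end

context bialgebra_over
begin

lemma eq_on_span_coefficients:
  assumes W: "is_vspace W" and G: "linear_map A W G" and H: "linear_map A W H"
    and span: "module.span (vscale A) (\<Union>M\<in>R. coefficient_coalgebra A M) = vcarrier A"
    and eq: "\<And>M m \<phi>. \<lbrakk>M \<in> R; m \<in> vcarrier M; linear_map M ground \<phi>\<rbrakk> \<Longrightarrow>
      G (tlift M A (\<lambda>n y. vscale A (\<phi> n) y) (coact M m))
      = H (tlift M A (\<lambda>n y. vscale A (\<phi> n) y) (coact M m))"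
  shows "G = H"
proof
  fix c
  interpret vector_space "vscale A" using is_vspace_A by (simp add: is_vspace_def)
  have sub: "subspace {c. G c = H c}"
    by (rule subspaceI)
       (simp_all add: linear_mapD[OF G] linear_mapD[OF H] linear_map_0[OF is_vspace_A G]
         linear_map_0[OF is_vspace_A H])
  have "coefficient_coalgebra A M \<subseteq> {c. G c = H c}" if "M \<in> R" for M
    unfolding coefficient_coalgebra_def
    by (rule span_minimal[OF _ sub]) (use eq that in blast)
  then have "span (\<Union>M\<in>R. coefficient_coalgebra A M) \<subseteq> {c. G c = H c}"
    by (intro span_minimal[OF _ sub]) blast
  then show "G c = H c" using span by auto
qed

theorem yetter_drinfeld_family_iff_braiding:
  fixes R :: "('k, 'm::ab_group_add, 'a) comod set"
  assumes R: "\<forall>M\<in>R. right_comodule A M"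
    and span: "module.span (vscale A) (\<Union>M\<in>R. coefficient_coalgebra A M) = vcarrier A"
    and \<kappa>: "bilinear_map A A ground \<kappa>"
  shows "(\<forall>M\<in>R. yetter_drinfeld A M (\<lambda>m a. tlift M A (\<lambda>n y. vscale M (\<kappa> a y) n) (coact M m)))
    \<longleftrightarrow> braiding \<kappa>" (is "?yd \<longleftrightarrow> _")
proof -
  have loc: "comodule_over A M" if "M \<in> R" for M
    using R that by unfold_locales blast
  have form_action: "(\<lambda>m a. tlift M A (\<lambda>n y. vscale M (\<kappa> a y) n) (coact M m)) =
    comodule_over.form_action A M \<kappa>" if "M \<in> R" for M
    using comodule_over.form_action_def[OF loc[OF that]] by (simp add: fun_eq_iff)
  note iff = comodule_over.yetter_drinfeld_form_action_iff[OF loc \<kappa>]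
  have lin: "linear_map A ground (\<kappa> a)" for a using \<kappa> by (simp add: bilinear_map_def)
  show ?thesis
  proof
    assume "braiding \<kappa>"
    then show ?yd
      unfolding braiding_def commutes_def by (simp add: form_action iff)
  next
    assume yd': ?yd
    have yd: "yetter_drinfeld A M (comodule_over.form_action A M \<kappa>)" if "M \<in> R" for M
      using bspec[OF yd' that] unfolding form_action[OF that] .
    have scalar: "G = H"
      if "linear_map A ground G" "linear_map A ground H"
        and "\<And>M m. \<lbrakk>M \<in> R; m \<in> vcarrier M\<rbrakk> \<Longrightarrow>
          tlift M A (\<lambda>n y. vscale M (G y) n) (coact M m) = tlift M A (\<lambda>n y. vscale M (H y) n) (coact M m)"
      for G H
      by (rule eq_on_span_coefficients[OF is_vspace_ground that(1,2) span])
         (rule comodule_over.eq_on_coefficients_scale[OF loc that(1,2)]; (assumption | rule that(3))+)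
    have vector: "G = H"
      if "linear_map A A G" "linear_map A A H"
        and "\<And>M m. \<lbrakk>M \<in> R; m \<in> vcarrier M\<rbrakk> \<Longrightarrow>
          tlift M A (\<lambda>n y. tens M A n (G y)) (coact M m) = tlift M A (\<lambda>n y. tens M A n (H y)) (coact M m)"
      for G H
      by (rule eq_on_span_coefficients[OF is_vspace_A that(1,2) span])
         (rule comodule_over.eq_on_coefficients_tens[OF loc is_vspace_A that(1,2)]; (assumption | rule that(3))+)
    have "\<kappa> 1 = \<epsilon>"
      by (rule scalar[OF lin linear_counit]) (use yd iff in blast)
    moreover have "\<kappa> (a * b) = \<kappa> b \<star> \<kappa> a" for a b
      by (rule scalar[OF lin linear_convolution[OF unital_assoc_ground lin lin]]) (use yd iff in blast)
    moreover have "(\<lambda>c. sweedler c (\<lambda>x y. sweedler a (\<lambda>u v. vscale A (\<kappa> u x) (y * v))))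
       = (\<lambda>c. sweedler c (\<lambda>x y. sweedler a (\<lambda>u v. vscale A (\<kappa> v y) (u * x))))" for a
      by (rule vector[OF linear_sweedler[OF is_vspace_A commutation_bilinear(1)[OF \<kappa>]]
            linear_sweedler[OF is_vspace_A commutation_bilinear(2)[OF \<kappa>]]])
         (use yd iff in blast)
    ultimately show "braiding \<kappa>" unfolding braiding_def commutes_def by (simp add: fun_eq_iff)
  qed
qed

end

theorem proposition2p3:
  fixes A :: "('k::field, 'a::ring_1) bialg"
    and R :: "('k, 'm::ab_group_add, 'a) comod set"
    and r :: "('k, 'a, 'a) tensor \<Rightarrow> 'k"
  assumes "bialgebra A"
    and "\<forall>M\<in>R. right_comodule A M"
    and "module.span (vscale A) (\<Union>M\<in>R. coefficient_coalgebra A M) = vcarrier A"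
    and "linear_functional2 A r"
    and "convolution_invertible A r"
  shows "universal_r_form A r \<longleftrightarrow>
    (\<forall>M\<in>R. yetter_drinfeld A M (act1 A r M) \<and> yetter_drinfeld A M (act2 A r M))"
proof -
  interpret bialgebra_over A by unfold_locales fact
  let ?s = "convolution_inverse A r"
  have s: "is_convolution_inverse A r ?s"
    using assms(5) unfolding convolution_invertible_def convolution_inverse_def by (rule someI_ex)
  have \<rho>: "bilinear_map A A ground (\<lambda>a c. r (tens A A c a))"
    using bilinear_form_of_functional[OF assms(4)] by (auto simp: bilinear_map_def)
  have \<sigma>: "bilinear_map A A ground (\<lambda>a c. ?s (tens A A a c))"
    using s by (auto simp: is_convolution_inverse_def intro: bilinear_form_of_functional)
  show ?thesis
    unfolding universal_r_form_iff_braiding[OF assms(4) s]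
      yetter_drinfeld_family_iff_braiding[OF assms(2,3) \<rho>, symmetric]
      yetter_drinfeld_family_iff_braiding[OF assms(2,3) \<sigma>, symmetric]
      act1_def[abs_def] act2_def[abs_def]
    by blast
qed

end
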